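(* Let $\mathfrak{g}$ be the Lie algebra of a compact Lie group $G$, equipped with a positive definite invariant inner product $\langle\cdot,\cdot\rangle$, and let $\{X_i\}$ be an orthonormal basis of $\mathfrak{g}$. For $t\in\mathbb{R}$ let $$\mathcal{D}_t:=\sum_i X_i\otimes X_i+tH\in \mathbb{C}l(\mathfrak{g})\otimes\mathcal{U}(\mathfrak{g}),\qquad H:=\frac14\sum_{j,k,l}X_jX_kX_l\otimes\langle X_j,[X_k,X_l]\rangle .$$ Then $$\mathcal{D}_t^2=(\pi\otimes 1)\,T_t,$$ where $T_t\in\mathcal{U}(\mathfrak{g})\otimes\mathcal{U}(\mathfrak{g})$ is $$T_t:=1\otimes \mathrm{Cas}+(3t-1)\big(\Delta\mathrm{Cas}-1\otimes\mathrm{Cas}-\mathrm{Cas}\otimes 1\big)+9t^2|\rho|^2 .$$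
   Context: $\mathbb{C}l(\mathfrak{g})$ is the complex Clifford algebra generated by $\mathfrak{g}$ with relations $XY+YX=-2\langle X,Y\rangle$ for $X,Y\in\mathfrak{g}$; $\mathcal{U}(\mathfrak{g})$ is the universal enveloping algebra. $\mathrm{Cas}:=-\sum_i X_i^2\in\mathcal{U}(\mathfrak{g})$ is the Casimir element. $\Delta:\mathcal{U}(\mathfrak{g})\to\mathcal{U}(\mathfrak{g})\otimes\mathcal{U}(\mathfrak{g})$ is the coproduct, the algebra homomorphism with $\Delta(X)=X\otimes1+1\otimes X$ for $X\in\mathfrak{g}$. The map $\pi:\mathfrak{g}\to\mathbb{C}l(\mathfrak{g})$, $\pi(X_i):=\frac14\sum_{k,l}\langle X_i,[X_k,X_l]\rangle X_kX_l$, is a Lie algebra homomorphism (with the commutator bracket on $\mathbb{C}l(\mathfrak{g})$) and is extended to an algebra homomorphism $\pi:\mathcal{U}(\mathfrak{g})\to\mathbb{C}l(\mathfrak{g})$. $\rho$ is the Weyl vector (half the sum of the positive roots) of $\mathfrak{g}$ with respect to a chosen maximal torus and positive system, and $|\rho|^2$ is its squared norm for the inner product induced on weights by $\langle\cdot,\cdot\rangle$. *)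

theory Defs
  imports "HOL-Analysis.Analysis"
begin

text \<open>An element of the free associative C-algebra on letters of type 'a is represented by
its coefficient function on words (lists of letters). All elements used below have finite
support.\<close>

type_synonym 'a fa = "'a list \<Rightarrow> complex"

definition fa_zero :: "'a fa" where "fa_zero = (\<lambda>w. 0)"
definition fa_one :: "'a fa" where "fa_one = (\<lambda>w. if w = [] then 1 else 0)"
definition fa_gen :: "'a \<Rightarrow> 'a fa" where "fa_gen a = (\<lambda>w. if w = [a] then 1 else 0)"
definition fa_add :: "'a fa \<Rightarrow> 'a fa \<Rightarrow> 'a fa" where "fa_add p q = (\<lambda>w. p w + q w)"
definition fa_diff :: "'a fa \<Rightarrow> 'a fa \<Rightarrow> 'a fa" where "fa_diff p q = (\<lambda>w. p w - q w)"
definition fa_smult :: "complex \<Rightarrow> 'a fa \<Rightarrow> 'a fa" where "fa_smult c p = (\<lambda>w. c * p w)"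
definition fa_sum :: "('i \<Rightarrow> 'a fa) \<Rightarrow> 'i set \<Rightarrow> 'a fa" where
  "fa_sum f A = (\<lambda>w. \<Sum>i\<in>A. f i w)"
definition fa_mult :: "'a fa \<Rightarrow> 'a fa \<Rightarrow> 'a fa" where
  "fa_mult p q = (\<lambda>w. \<Sum>i\<le>length w. p (take i w) * q (drop i w))"

text \<open>Algebra homomorphism of free algebras determined by the images of the letters
(defined for finitely supported elements).\<close>
definition fa_word_img :: "('a \<Rightarrow> 'b fa) \<Rightarrow> 'a list \<Rightarrow> 'b fa" where
  "fa_word_img f v = foldr (\<lambda>a acc. fa_mult (f a) acc) v fa_one"
definition fa_hom :: "('a \<Rightarrow> 'b fa) \<Rightarrow> 'a fa \<Rightarrow> 'b fa" where
  "fa_hom f p = (\<lambda>w. \<Sum>v\<in>{v. p v \<noteq> 0}. p v * fa_word_img f v w)"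

inductive_set fa_ideal :: "'a fa set \<Rightarrow> 'a fa set" for R :: "'a fa set" where
  gen: "r \<in> R \<Longrightarrow> r \<in> fa_ideal R"
| zero: "fa_zero \<in> fa_ideal R"
| add: "p \<in> fa_ideal R \<Longrightarrow> q \<in> fa_ideal R \<Longrightarrow> fa_add p q \<in> fa_ideal R"
| smult: "p \<in> fa_ideal R \<Longrightarrow> fa_smult c p \<in> fa_ideal R"
| lmult: "p \<in> fa_ideal R \<Longrightarrow> fa_mult (fa_gen a) p \<in> fa_ideal R"
| rmult: "p \<in> fa_ideal R \<Longrightarrow> fa_mult p (fa_gen a) \<in> fa_ideal R"

text \<open>g is modelled by a finite-dimensional real inner product space 'g (type class
euclidean_space, whose inner product is the given positive definite inner product), with a
Lie bracket br; X i (i < n) is an orthonormal basis.\<close>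

definition lie_algebra :: "('g::euclidean_space \<Rightarrow> 'g \<Rightarrow> 'g) \<Rightarrow> bool" where
  "lie_algebra br \<longleftrightarrow> bilinear br \<and> (\<forall>x. br x x = 0) \<and>
     (\<forall>x y z. br x (br y z) + br y (br z x) + br z (br x y) = 0)"

definition invariant_ip :: "('g::euclidean_space \<Rightarrow> 'g \<Rightarrow> 'g) \<Rightarrow> bool" where
  "invariant_ip br \<longleftrightarrow> (\<forall>x y z. inner (br x y) z = - inner y (br x z))"

definition orthonormal_basis :: "nat \<Rightarrow> (nat \<Rightarrow> 'g::euclidean_space) \<Rightarrow> bool" where
  "orthonormal_basis n X \<longleftrightarrow> n = DIM('g) \<and>
     (\<forall>i<n. \<forall>j<n. inner (X i) (X j) = (if i = j then 1 else 0))"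

definition sc :: "('g::euclidean_space \<Rightarrow> 'g \<Rightarrow> 'g) \<Rightarrow> (nat \<Rightarrow> 'g) \<Rightarrow> nat \<Rightarrow> nat \<Rightarrow> nat \<Rightarrow> real" where
  "sc br X j k l = inner (X j) (br (X k) (X l))"

text \<open>Letters of Cl(g) (x) U(g): Inl i stands for X_i (x) 1 (Clifford generator),
Inr i for 1 (x) X_i (enveloping algebra generator).
Letters of U(g) (x) U(g): Inl i stands for X_i (x) 1, Inr i for 1 (x) X_i.\<close>

abbreviation cl_e :: "nat \<Rightarrow> (nat + nat) fa" where "cl_e i \<equiv> fa_gen (Inl i)"
abbreviation cl_u :: "nat \<Rightarrow> (nat + nat) fa" where "cl_u i \<equiv> fa_gen (Inr i)"

definition clU_relators :: "('g::euclidean_space \<Rightarrow> 'g \<Rightarrow> 'g) \<Rightarrow> (nat \<Rightarrow> 'g) \<Rightarrow> nat \<Rightarrow> (nat + nat) fa set" where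
  "clU_relators br X n =
     {fa_add (fa_add (fa_mult (cl_e i) (cl_e j)) (fa_mult (cl_e j) (cl_e i)))
             (fa_smult (complex_of_real (2 * inner (X i) (X j))) fa_one) | i j. i < n \<and> j < n}
   \<union> {fa_diff (fa_diff (fa_mult (cl_u i) (cl_u j)) (fa_mult (cl_u j) (cl_u i)))
             (fa_sum (\<lambda>k. fa_smult (complex_of_real (sc br X k i j)) (cl_u k)) {..<n}) | i j. i < n \<and> j < n}
   \<union> {fa_diff (fa_mult (cl_e i) (cl_u j)) (fa_mult (cl_u j) (cl_e i)) | i j. i < n \<and> j < n}"

definition clU_eq :: "('g::euclidean_space \<Rightarrow> 'g \<Rightarrow> 'g) \<Rightarrow> (nat \<Rightarrow> 'g) \<Rightarrow> nat \<Rightarrow> (nat + nat) fa \<Rightarrow> (nat + nat) fa \<Rightarrow> bool" where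
  "clU_eq br X n p q \<longleftrightarrow> fa_diff p q \<in> fa_ideal (clU_relators br X n)"

definition cubic_H :: "('g::euclidean_space \<Rightarrow> 'g \<Rightarrow> 'g) \<Rightarrow> (nat \<Rightarrow> 'g) \<Rightarrow> nat \<Rightarrow> (nat + nat) fa" where
  "cubic_H br X n = fa_smult (1/4)
     (fa_sum (\<lambda>(j,k,l). fa_smult (complex_of_real (sc br X j k l))
        (fa_mult (cl_e j) (fa_mult (cl_e k) (cl_e l)))) ({..<n} \<times> {..<n} \<times> {..<n}))"

definition dirac_D :: "('g::euclidean_space \<Rightarrow> 'g \<Rightarrow> 'g) \<Rightarrow> (nat \<Rightarrow> 'g) \<Rightarrow> nat \<Rightarrow> real \<Rightarrow> (nat + nat) fa" where
  "dirac_D br X n t = fa_add (fa_sum (\<lambda>i. fa_mult (cl_e i) (cl_u i)) {..<n})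
                              (fa_smult (complex_of_real t) (cubic_H br X n))"

definition pi_gen :: "('g::euclidean_space \<Rightarrow> 'g \<Rightarrow> 'g) \<Rightarrow> (nat \<Rightarrow> 'g) \<Rightarrow> nat \<Rightarrow> nat \<Rightarrow> (nat + nat) fa" where
  "pi_gen br X n i = fa_smult (1/4)
     (fa_sum (\<lambda>(k,l). fa_smult (complex_of_real (sc br X i k l)) (fa_mult (cl_e k) (cl_e l)))
        ({..<n} \<times> {..<n}))"

definition pi_tensor_one :: "('g::euclidean_space \<Rightarrow> 'g \<Rightarrow> 'g) \<Rightarrow> (nat \<Rightarrow> 'g) \<Rightarrow> nat \<Rightarrow> (nat + nat) fa \<Rightarrow> (nat + nat) fa" where
  "pi_tensor_one br X n = fa_hom (\<lambda>a. case a of Inl i \<Rightarrow> pi_gen br X n i | Inr i \<Rightarrow> cl_u i)"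

definition cas_left :: "nat \<Rightarrow> (nat + nat) fa" where
  "cas_left n = fa_smult (-1) (fa_sum (\<lambda>i. fa_mult (fa_gen (Inl i)) (fa_gen (Inl i))) {..<n})"
definition cas_right :: "nat \<Rightarrow> (nat + nat) fa" where
  "cas_right n = fa_smult (-1) (fa_sum (\<lambda>i. fa_mult (fa_gen (Inr i)) (fa_gen (Inr i))) {..<n})"
definition cas_coproduct :: "nat \<Rightarrow> (nat + nat) fa" where
  "cas_coproduct n = fa_smult (-1) (fa_sum (\<lambda>i.
      fa_mult (fa_add (fa_gen (Inl i)) (fa_gen (Inr i))) (fa_add (fa_gen (Inl i)) (fa_gen (Inr i)))) {..<n})"

definition T_elem :: "nat \<Rightarrow> real \<Rightarrow> real \<Rightarrow> (nat + nat) fa" where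
  "T_elem n t rho2 = fa_add (fa_add (cas_right n)
      (fa_smult (complex_of_real (3 * t - 1))
         (fa_diff (fa_diff (cas_coproduct n) (cas_right n)) (cas_left n))))
      (fa_smult (complex_of_real (9 * t^2 * rho2)) fa_one)"

text \<open>The Lie algebra of a maximal torus of G is a maximal abelian subalgebra of g.\<close>
definition abelian_subalgebra :: "('g::euclidean_space \<Rightarrow> 'g \<Rightarrow> 'g) \<Rightarrow> 'g set \<Rightarrow> bool" where
  "abelian_subalgebra br T \<longleftrightarrow> subspace T \<and> (\<forall>x\<in>T. \<forall>y\<in>T. br x y = 0)"

definition maximal_torus :: "('g::euclidean_space \<Rightarrow> 'g \<Rightarrow> 'g) \<Rightarrow> 'g set \<Rightarrow> bool" where
  "maximal_torus br T \<longleftrightarrow> abelian_subalgebra br T \<and>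
     (\<forall>S. abelian_subalgebra br S \<and> T \<subseteq> S \<longrightarrow> S = T)"

text \<open>Real weights are identified with vectors of t via the inner product. alpha is a root iff
alpha \<noteq> 0 and there is Z = Z1 + i Z2 \<noteq> 0 in the complexification of g with
ad(H) Z = i <alpha, H> Z for all H in t.\<close>
definition roots :: "('g::euclidean_space \<Rightarrow> 'g \<Rightarrow> 'g) \<Rightarrow> 'g set \<Rightarrow> 'g set" where
  "roots br T = {\<alpha> \<in> T. \<alpha> \<noteq> 0 \<and> (\<exists>Z1 Z2. (Z1, Z2) \<noteq> (0, 0) \<and>
      (\<forall>H\<in>T. br H Z1 = - (inner \<alpha> H) *\<^sub>R Z2 \<and> br H Z2 = (inner \<alpha> H) *\<^sub>R Z1))}"

definition positive_system :: "('g::euclidean_space \<Rightarrow> 'g \<Rightarrow> 'g) \<Rightarrow> 'g set \<Rightarrow> 'g set \<Rightarrow> bool" where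
  "positive_system br T P \<longleftrightarrow> (\<exists>w\<in>T. (\<forall>\<alpha>\<in>roots br T. inner \<alpha> w \<noteq> 0) \<and>
      P = {\<alpha> \<in> roots br T. inner \<alpha> w > 0})"

definition weyl_vector :: "'g::euclidean_space set \<Rightarrow> 'g" where
  "weyl_vector P = (1/2) *\<^sub>R (\<Sum>\<alpha>\<in>P. \<alpha>)"

end

theory Submission
  imports Defs
begin

text \<open>Modulo the relations, \<open>X\<^sub>i H + H X\<^sub>i = - 6 \<pi>(X\<^sub>i)\<close>, which gives the coefficient
  \<open>3t - 1\<close>. As \<open>H = \<Sum>\<^sub>i X\<^sub>i \<pi>(X\<^sub>i)\<close> commutes with each \<open>\<pi>(X\<^sub>i)\<close>, it also gives
  \<open>H\<^sup>2 = - 3 \<Sum>\<^sub>i \<pi>(X\<^sub>i)\<^sup>2\<close>, and the Jacobi identity removes the quartic part of this sum, so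
  \<open>H\<^sup>2 = 3/8 \<Sum>\<^sub>i\<^sub>j |[X\<^sub>i, X\<^sub>j]|\<^sup>2\<close>. What remains is the strange formula of Freudenthal and
  de Vries in the form \<open>\<Sum>\<^sub>i\<^sub>j |[X\<^sub>i, X\<^sub>j]|\<^sup>2 = 24 |\<rho>|\<^sup>2\<close>.

  For it, let \<open>J\<close> be the complex structure that the positive roots define on the orthogonal
  complement of the torus, extended by \<open>0\<close>. Summing over an orthonormal basis,
  \<open>\<Sum> [e, J e] = - 4 \<rho>\<close>, so the Jacobi identity and the skewness of \<open>J\<close> yield \<open>8 |\<rho>|\<^sup>2 = \<Sum> \<langle>[e, f], [J e, J f]\<rangle>\<close>. A sum of three positive roots is
  never \<open>0\<close>, so the 3-form \<open>\<langle>[x, y], z\<rangle>\<close> has no \<open>(3,0)\<close> part; pairing the resulting identity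
  with the form itself gives \<open>\<Sum> |[e, f]|\<^sup>2 = 3 \<Sum> \<langle>[e, f], [J e, J f]\<rangle>\<close>.\<close>

subsection \<open>The strange formula\<close>

text \<open>Variational argument: on the unit sphere of \<open>V\<close> the quadratic form of
  \<open>S\<close> attains a maximum \<open>c\<close> at some \<open>x\<close>, and the residual
  \<open>S x - c *\<^sub>R x\<close> would be a direction of first-order increase unless it
  vanished.\<close>

lemma symmetric_eigenvector:
  fixes S :: "'a::euclidean_space \<Rightarrow> 'a"
  assumes S: "linear S" and V: "subspace V" "V \<noteq> {0}"
    and inv: "\<And>x. x \<in> V \<Longrightarrow> S x \<in> V"
    and sym: "\<And>x y. x \<in> V \<Longrightarrow> y \<in> V \<Longrightarrow> inner (S x) y = inner x (S y)"
  obtains x c where "x \<in> V" "x \<noteq> 0" "S x = c *\<^sub>R x"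
proof -
  obtain z where z: "z \<in> V" "z \<noteq> 0" using V subspace_0 by blast
  then have "(1 / norm z) *\<^sub>R z \<in> V \<inter> sphere 0 1"
    using V by (auto simp: subspace_scale)
  then have "V \<inter> sphere 0 1 \<noteq> {}" by blast
  moreover have "compact (V \<inter> sphere 0 1)"
    using closed_subspace[OF V(1)] by (metis compact_sphere closed_Int_compact)
  moreover have "continuous_on (V \<inter> sphere 0 1) (\<lambda>x. inner (S x) x)"
    by (intro continuous_intros linear_continuous_on) (use S linear_conv_bounded_linear in blast)
  ultimately have "\<exists>x\<in>V \<inter> sphere 0 1. \<forall>y\<in>V \<inter> sphere 0 1. inner (S y) y \<le> inner (S x) x"
    using continuous_attains_sup by blast
  then obtain x where x: "x \<in> V" "norm x = 1"
    and max: "\<And>y. y \<in> V \<Longrightarrow> norm y = 1 \<Longrightarrow> inner (S y) y \<le> inner (S x) x"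
    by auto
  define c where "c = inner (S x) x"
  have le: "inner (S y) y \<le> c * inner y y" if "y \<in> V" for y
  proof (cases "y = 0")
    case False
    have "inner (S ((1 / norm y) *\<^sub>R y)) ((1 / norm y) *\<^sub>R y) \<le> c"
      unfolding c_def using False that V by (intro max) (auto simp: subspace_scale)
    then have "inner (S y) y / (norm y)^2 \<le> c"
      by (simp add: linear_scale[OF S] power2_eq_square)
    then show ?thesis using False by (simp add: divide_le_eq power2_norm_eq_inner mult.commute)
  qed (simp add: linear_0[OF S])
  define y where "y = S x - c *\<^sub>R x"
  have yV: "y \<in> V" unfolding y_def using x V inv by (simp add: subspace_diff subspace_scale)
  have xx: "inner x x = 1" using x by (simp add: norm_eq_1)
  define q where "q = inner (S y) y - c * inner y y"
  \<comment> \<open>This is \<open>le\<close> at \<open>x + s *\<^sub>R y\<close>. The linear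
    coefficient is 2 |y|^2 because \<open>y\<close> is the residual itself.\<close>
  have *: "2 * s * inner y y + s\<^sup>2 * q \<le> 0" for s
  proof -
    have "inner (S y) x = inner y (S x)" using sym x yV by simp
    then have "inner (S (x + s *\<^sub>R y)) (x + s *\<^sub>R y) =
        c + 2 * s * inner y (S x) + s\<^sup>2 * inner (S y) y"
      by (simp add: linear_add[OF S] linear_scale[OF S] inner_add_left inner_add_right c_def
        inner_commute power2_eq_square)
    moreover have "inner (x + s *\<^sub>R y) (x + s *\<^sub>R y) = 1 + 2 * s * inner y x + s\<^sup>2 * inner y y"
      using xx by (simp add: inner_add_left inner_add_right inner_commute power2_eq_square)
    moreover have "inner (S (x + s *\<^sub>R y)) (x + s *\<^sub>R y) \<le> c * inner (x + s *\<^sub>R y) (x + s *\<^sub>R y)"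
      using x yV V by (intro le) (simp add: subspace_add subspace_scale)
    ultimately have "c + 2 * s * inner y (S x) + s\<^sup>2 * inner (S y) y
        \<le> c * (1 + 2 * s * inner y x + s\<^sup>2 * inner y y)"
      by (simp only:)
    then have "2 * s * (inner y (S x) - c * inner y x) + s\<^sup>2 * q \<le> 0"
      by (simp add: q_def algebra_simps)
    also have "inner y (S x) - c * inner y x = inner y y" by (simp add: y_def inner_diff_right)
    finally show ?thesis .
  qed
  have "y = 0"
  proof (rule ccontr)
    assume "y \<noteq> 0"
    then have b: "inner y y > 0" by simp
    \<comment> \<open>At s = |y|^2 / K the bound becomes |y|^4 (2 K + q) / K^2 <= 0, and this
      \<open>K\<close> makes 2 K + q positive.\<close>
    define K where "K = \<bar>q\<bar> + 1"
    have K: "K > 0" "q > - K" by (auto simp: K_def)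
    have "2 * (inner y y / K) * inner y y + (inner y y / K)\<^sup>2 * q \<le> 0" by (rule *)
    then have "(inner y y)\<^sup>2 * (2 * K + q) \<le> 0"
      using K by (simp add: field_simps power2_eq_square)
    moreover have "(inner y y)\<^sup>2 * (2 * K + q) > 0" using b K by simp
    ultimately show False by simp
  qed
  moreover have "x \<noteq> 0" using x by auto
  ultimately show ?thesis using that[of x c] x by (simp add: y_def)
qed

section \<open>Lie algebras with an invariant inner product\<close>

locale compact_lie =
  fixes br :: "'g::euclidean_space \<Rightarrow> 'g \<Rightarrow> 'g"
  assumes lie: "lie_algebra br" and inv: "invariant_ip br"
begin

lemma bil: "bilinear br" using lie by (simp add: lie_algebra_def)

lemmas br_simps = bilinear_ladd[OF bil] bilinear_radd[OF bil] bilinear_lmul[OF bil]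
  bilinear_rmul[OF bil] bilinear_lneg[OF bil] bilinear_rneg[OF bil] bilinear_lzero[OF bil]
  bilinear_rzero[OF bil] bilinear_lsub[OF bil] bilinear_rsub[OF bil]

lemma br_self [simp]: "br x x = 0" using lie by (simp add: lie_algebra_def)

lemma br_linear: "linear (br x)" using bil by (simp add: bilinear_def)

lemma br_linear_left: "linear (\<lambda>x. br x y)" using bil by (simp add: bilinear_def)

lemma br_anti: "br x y = - br y x"
proof -
  have "br (x + y) (x + y) = br x x + br x y + (br y x + br y y)"
    by (simp only: bilinear_ladd[OF bil] bilinear_radd[OF bil] ac_simps)
  then have "br x y + br y x = 0" by simp
  then show ?thesis by (simp add: eq_neg_iff_add_eq_0)
qed

lemma jacobi: "br x (br y z) = br (br x y) z + br y (br x z)"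
proof -
  have "br x (br y z) + br y (br z x) + br z (br x y) = 0"
    using lie by (simp add: lie_algebra_def)
  moreover have "br y (br z x) = - br y (br x z)" by (subst br_anti[of z x]) (simp add: br_simps)
  moreover have "br z (br x y) = - br (br x y) z" by (rule br_anti)
  ultimately show ?thesis by (simp add: algebra_simps eq_neg_iff_add_eq_0)
qed

lemma inner_br: "inner (br x y) z = - inner y (br x z)"
  using inv by (simp add: invariant_ip_def)

lemma inner_br_cyc: "inner (br x y) z = inner x (br y z)"
  by (subst br_anti) (simp add: inner_br)

end

section \<open>Maximal tori and root vectors\<close>

locale compact_lie_torus = compact_lie +
  fixes T :: "'g::euclidean_space set"
  assumes torus: "maximal_torus br T"
begin

lemma T_subspace: "subspace T" and T_abelian: "x \<in> T \<Longrightarrow> y \<in> T \<Longrightarrow> br x y = 0"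
  using torus by (auto simp: maximal_torus_def abelian_subalgebra_def)

text \<open>Maximality of \<open>T\<close>: the span of \<open>T\<close> and \<open>z\<close> is
  still abelian, so it equals \<open>T\<close>.\<close>

lemma centralizer_T:
  assumes "\<And>H. H \<in> T \<Longrightarrow> br H z = 0"
  shows "z \<in> T"
proof -
  have ex: "\<exists>h\<in>T. \<exists>k. x = h + k *\<^sub>R z" if "x \<in> span (insert z T)" for x
  proof -
    obtain k where "x - k *\<^sub>R z \<in> span T" using \<open>x \<in> _\<close> by (auto simp: span_insert)
    then show ?thesis using span_eq_iff[of T] T_subspace by (metis diff_add_cancel)
  qed
  have z': "br z H = 0" if "H \<in> T" for H using assms[OF that] br_anti[of z H] by simp
  have "abelian_subalgebra br (span (insert z T))"
    unfolding abelian_subalgebra_def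
  proof (intro conjI ballI)
    fix x y assume "x \<in> span (insert z T)" "y \<in> span (insert z T)"
    then obtain h k h' k' where "h \<in> T" "h' \<in> T" "x = h + k *\<^sub>R z" "y = h' + k' *\<^sub>R z"
      using ex by metis
    then show "br x y = 0" by (simp add: br_simps assms z' T_abelian)
  qed simp
  moreover have "T \<subseteq> span (insert z T)" by (meson span_superset subset_insertI subset_trans)
  ultimately have "span (insert z T) = T" using torus by (auto simp: maximal_torus_def)
  then show ?thesis by (metis insertI1 span_base)
qed

text \<open>The equation [H, Z] = i <\<alpha>, H> Z for Z = u + i v, split into real and imaginary
  parts.\<close>

definition root_pair :: "'g \<Rightarrow> 'g \<Rightarrow> 'g \<Rightarrow> bool" where
  "root_pair \<alpha> u v \<longleftrightarrow> (\<forall>H\<in>T. br H u = - (inner \<alpha> H) *\<^sub>R v \<and> br H v = (inner \<alpha> H) *\<^sub>R u)"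

lemma roots_iff:
  "\<alpha> \<in> roots br T \<longleftrightarrow> \<alpha> \<in> T \<and> \<alpha> \<noteq> 0 \<and> (\<exists>u v. (u, v) \<noteq> (0, 0) \<and> root_pair \<alpha> u v)"
  by (simp add: roots_def root_pair_def)

lemma root_pairD:
  assumes "root_pair \<alpha> u v" "H \<in> T"
  shows "br H u = - (inner \<alpha> H) *\<^sub>R v" "br H v = (inner \<alpha> H) *\<^sub>R u"
  using assms by (auto simp: root_pair_def)

lemma ad_T_commute: "H \<in> T \<Longrightarrow> H' \<in> T \<Longrightarrow> br H (br H' x) = br H' (br H x)"
  using jacobi[of H H' x] T_abelian by (simp add: br_simps)

text \<open>Take a nonzero \<open>T\<close>-stable subspace of \<open>U\<close> of least dimension.
  Each product of two operators \<open>br H\<close> and \<open>br H'\<close> is symmetric and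
  commutes with the torus action, so it acts there as a scalar. Hence a vector and its image under
  one suitable \<open>br H0\<close> span a plane on which the whole torus acts by multiples of one
  quarter turn.\<close>

lemma exists_root_pair:
  assumes U: "subspace U" "U \<noteq> {0}"
    and invU: "\<And>H x. H \<in> T \<Longrightarrow> x \<in> U \<Longrightarrow> br H x \<in> U"
    and perp: "\<And>H x. H \<in> T \<Longrightarrow> x \<in> U \<Longrightarrow> inner x H = 0"
  obtains \<alpha> u v where "\<alpha> \<in> T" "\<alpha> \<noteq> 0" "u \<in> U" "u \<noteq> 0" "root_pair \<alpha> u v"
proof -
  define Q where "Q V \<longleftrightarrow> subspace V \<and> V \<noteq> {0} \<and> V \<subseteq> U \<and> (\<forall>H\<in>T. \<forall>x\<in>V. br H x \<in> V)" for V
  have "Q U" using U invU by (auto simp: Q_def)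
  then obtain V where V: "Q V" and least: "\<And>V'. Q V' \<Longrightarrow> dim V \<le> dim V'"
    using ex_has_least_nat[of Q U dim] by blast
  have sV: "subspace V" "V \<noteq> {0}" "V \<subseteq> U" and iV: "\<And>H x. H \<in> T \<Longrightarrow> x \<in> V \<Longrightarrow> br H x \<in> V"
    using V by (auto simp: Q_def)
  have scalar: "\<exists>c. \<forall>x\<in>V. br H (br H' x) = c *\<^sub>R x" if H: "H \<in> T" "H' \<in> T" for H H'
  proof -
    define S where "S x = br H (br H' x)" for x
    have S: "linear S" unfolding S_def
      using linear_compose[OF br_linear br_linear] by (simp add: o_def)
    have "S x \<in> V" if "x \<in> V" for x using that H iV by (simp add: S_def)
    moreover have "inner (S x) y = inner x (S y)" for x y
      unfolding S_def by (simp add: inner_br ad_T_commute[OF H])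
    ultimately obtain x c where x: "x \<in> V" "x \<noteq> 0" "S x = c *\<^sub>R x"
      using symmetric_eigenvector[OF S sV(1,2)] by metis
    \<comment> \<open>The eigenspace is \<open>T\<close>-stable because \<open>S\<close> commutes
      with each \<open>br K\<close>; minimality of \<open>V\<close> forces it to be all of
      \<open>V\<close>.\<close>
    define E where "E = {x \<in> V. S x = c *\<^sub>R x}"
    have "subspace E"
      using sV(1) S by (auto simp: E_def subspace_def linear_add linear_scale linear_0 algebra_simps)
    moreover have "br K x \<in> E" if "K \<in> T" "x \<in> E" for K x
    proof -
      have "S (br K x) = br K (S x)" unfolding S_def using H that by (simp add: ad_T_commute)
      then show ?thesis using that iV by (simp add: E_def br_simps)
    qed
    moreover have "x \<in> E" using x by (simp add: E_def)
    moreover have "E \<subseteq> V" by (auto simp: E_def)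
    ultimately have "Q E" using sV x unfolding Q_def by blast
    then have "E = V" using least subspace_dim_equal[OF \<open>subspace E\<close> sV(1) \<open>E \<subseteq> V\<close>] by blast
    then show ?thesis unfolding E_def S_def by blast
  qed
  obtain x where x: "x \<in> V" "x \<noteq> 0" using sV subspace_0 by blast
  \<comment> \<open>\<open>U\<close> is orthogonal to \<open>T\<close>, so the nonzero
    \<open>x\<close> lies outside \<open>T\<close>, and by \<open>centralizer_T\<close> some
    \<open>H0\<close> moves it.\<close>
  have "x \<notin> T"
    using perp[of x x] x sV by auto
  then obtain H0 where H0: "H0 \<in> T" "br H0 x \<noteq> 0" using centralizer_T by blast
  define y where "y = br H0 x"
  obtain c0 where c0: "br H0 y = c0 *\<^sub>R x" unfolding y_def using scalar[OF H0(1) H0(1)] x by blast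
  have "inner y y = - c0 * inner x x"
    using inner_br[of H0 x y] c0 by (simp add: y_def)
  moreover have "inner y y > 0" using H0 by (simp add: y_def)
  ultimately have "- c0 * inner x x > 0" by simp
  moreover have "inner x x > 0" using x by simp
  ultimately have c0_neg: "c0 < 0" using zero_less_mult_pos2[of "- c0" "inner x x"] by simp
  \<comment> \<open>\<open>c0\<close> is negative by skewness, so \<open>br H0\<close> squares to
    -m^2 on \<open>x\<close>; scaling \<open>y\<close> by -1/m gives the signs demanded by
    \<open>root_pair\<close>.\<close>
  define m where "m = sqrt (- c0)"
  have m: "m > 0" "m * m = - c0" using c0_neg by (auto simp: m_def)
  define v where "v = - (1 / m) *\<^sub>R y"
  have "c0 / m = - m" using m by (simp add: field_simps)
  then have H0v: "br H0 x = - m *\<^sub>R v" "br H0 v = m *\<^sub>R x"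
    using m c0 by (auto simp: v_def y_def[symmetric] br_simps)
  have ex: "\<exists>a. br H x = - a *\<^sub>R v \<and> br H v = a *\<^sub>R x" if H: "H \<in> T" for H
  proof -
    obtain g where g: "\<forall>x\<in>V. br H (br H0 x) = g *\<^sub>R x" using scalar[OF H H0(1)] by blast
    have "br H v = (- g / m) *\<^sub>R x"
      using g x by (simp add: v_def y_def br_simps)
    moreover have "br H x = (1 / m) *\<^sub>R br H (br H0 v)" using H0v m by (simp add: br_simps)
    then have "br H x = (g / m) *\<^sub>R v" using g x iV H0 sV by (simp add: v_def y_def subspace_neg subspace_scale)
    ultimately show ?thesis by (intro exI[of _ "- g / m"]) simp
  qed
  \<comment> \<open>The only candidate: a root pair must satisfy [x, v] = -|x|^2 \<alpha>, compare
    \<open>root_pair_bracket\<close>.\<close>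
  define \<alpha> where "\<alpha> = - (1 / inner x x) *\<^sub>R br x v"
  have "\<alpha> \<in> T"
  proof (rule centralizer_T)
    fix H assume "H \<in> T"
    then obtain a where "br H x = - a *\<^sub>R v \<and> br H v = a *\<^sub>R x" using ex by blast
    then have "br H (br x v) = 0" by (simp add: jacobi[of H x v] br_simps)
    then show "br H \<alpha> = 0" by (simp add: \<alpha>_def br_simps)
  qed
  moreover have rp: "root_pair \<alpha> x v"
    unfolding root_pair_def
  proof
    fix H assume "H \<in> T"
    then obtain a where a: "br H x = - a *\<^sub>R v" "br H v = a *\<^sub>R x" using ex by blast
    have "inner \<alpha> H = - (1 / inner x x) * inner x (br v H)"
      by (simp add: \<alpha>_def inner_br_cyc)
    also have "br v H = - a *\<^sub>R x" using a(2) br_anti[of v H] by simp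
    finally have "inner \<alpha> H = a" using x by simp
    then show "br H x = - inner \<alpha> H *\<^sub>R v \<and> br H v = inner \<alpha> H *\<^sub>R x" using a by simp
  qed
  moreover have "\<alpha> \<noteq> 0" using root_pairD(1)[OF rp H0(1)] H0 by auto
  ultimately show ?thesis using that x sV by blast
qed

context
  fixes \<alpha> u v
  assumes \<alpha>: "\<alpha> \<in> T" "\<alpha> \<noteq> 0" and rp: "root_pair \<alpha> u v"
begin

text \<open>Skewness of \<open>br \<alpha>\<close>, tested on \<open>u, v\<close> and on
  \<open>u, u\<close>; the factor \<open>inner \<alpha> \<alpha>\<close> cancels.\<close>

lemma root_pair_norm: "inner v v = inner u u" and root_pair_orth: "inner u v = 0"
proof -
  note * = root_pairD[OF rp \<alpha>(1)]
  have "inner (br \<alpha> u) v = - inner u (br \<alpha> v)" by (rule inner_br)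
  then show "inner v v = inner u u" using \<alpha> * by simp
  have "inner (br \<alpha> u) u = - inner u (br \<alpha> u)" by (rule inner_br)
  then show "inner u v = 0" using \<alpha> * by (simp add: inner_commute)
qed

lemma root_pair_perp_T: assumes "H \<in> T" shows "inner u H = 0" "inner v H = 0"
proof -
  note * = root_pairD[OF rp \<alpha>(1)]
  have "inner (br \<alpha> u) H = 0" "inner (br \<alpha> v) H = 0"
    using assms \<alpha> T_abelian by (auto simp: inner_br)
  then show "inner v H = 0" "inner u H = 0" using \<alpha> * by auto
qed

text \<open>The bracket commutes with the torus and so lies in it. Invariance gives its pairing with
  each \<open>H\<close>, so the difference of the two sides is in \<open>T\<close> and orthogonal to
  \<open>T\<close>.\<close>

lemma root_pair_bracket: "br u v = - inner u u *\<^sub>R \<alpha>"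
proof -
  have "br H (br u v) = 0" if "H \<in> T" for H
    using root_pairD[OF rp that] by (simp add: jacobi[of H u v] br_simps)
  then have "br u v \<in> T" by (rule centralizer_T)
  then have d: "br u v + inner u u *\<^sub>R \<alpha> \<in> T"
    using \<alpha> T_subspace by (simp add: subspace_add subspace_scale)
  have "inner (br u v + inner u u *\<^sub>R \<alpha>) H = 0" if "H \<in> T" for H
  proof -
    have "inner (br u v) H = inner u (br v H)" by (rule inner_br_cyc)
    also have "br v H = - inner \<alpha> H *\<^sub>R u" using root_pairD(2)[OF rp that] br_anti[of v H] by simp
    finally show ?thesis by (simp add: inner_add_left)
  qed
  from this[OF d] show ?thesis by (simp add: eq_neg_iff_add_eq_0)
qed

text \<open>The Jacobi identity moves \<open>br u\<close> past \<open>br v\<close>; the extra term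
  is the action of \<open>br u v\<close>, a multiple of \<open>\<alpha>\<close>, on
  \<open>y\<close>. The case \<open>\<beta> = \<alpha>\<close> bounds the dimension of a root
  space.\<close>

lemma root_pair_jacobi:
  assumes "root_pair \<beta> x y"
  shows "inner (br u x) (br v y) - inner (br u y) (br v x) = inner \<alpha> \<beta> * inner u u * inner x x"
proof -
  have "inner (br u x) (br v y) = - inner x (br u (br v y))" by (rule inner_br)
  moreover have "inner (br u y) (br v x) = - inner x (br v (br u y))"
    by (subst inner_commute) (rule inner_br)
  moreover have "br u (br v y) = br (br u v) y + br v (br u y)" by (rule jacobi)
  moreover have "br (br u v) y = - inner u u *\<^sub>R inner \<beta> \<alpha> *\<^sub>R x"
    using root_pairD(2)[OF assms \<alpha>(1)] by (simp add: root_pair_bracket br_simps)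
  ultimately show ?thesis by (simp add: inner_add_right inner_diff_right inner_commute)
qed

text \<open>With \<open>e = u + iv\<close> and \<open>f = x + iy\<close> in the root space of \<open>\<alpha>\<close>, orthogonality puts
  \<open>[e\<^sup>*, f]\<close> into the torus and makes it vanish; the Jacobi identity then gives
  \<open>|[e, f]|\<^sup>2 = - |\<alpha>|\<^sup>2 |e|\<^sup>2 |f|\<^sup>2\<close>.\<close>

lemma root_space_one_dim:
  assumes u: "u \<noteq> 0" and xy: "root_pair \<alpha> x y" and xu: "inner x u = 0" and xv: "inner x v = 0"
  shows "x = 0"
proof -
  note * = root_pairD[OF rp \<alpha>(1)] root_pairD[OF xy \<alpha>(1)]
  have "inner (br \<alpha> x) u = - inner x (br \<alpha> u)" "inner (br \<alpha> x) v = - inner x (br \<alpha> v)"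
    by (rule inner_br)+
  then have yu: "inner y u = 0" and yv: "inner y v = 0" using * \<alpha> xu xv by auto
  have zero: "z = 0" if "\<And>H. H \<in> T \<Longrightarrow> br H z = 0" "\<And>H. H \<in> T \<Longrightarrow> inner z H = 0" for z
    using centralizer_T[OF that(1)] that(2)[of z] by auto
  have i: "inner (br a b) H = inner b (br H a)" for a b H
    using inner_br[of a b H] br_anti[of a H] by simp
  have "br u x + br v y = 0"
  proof (rule zero)
    fix H assume H: "H \<in> T"
    note h = root_pairD[OF rp H] root_pairD[OF xy H]
    show "br H (br u x + br v y) = 0"
      by (simp add: br_simps jacobi[of H] h)
    show "inner (br u x + br v y) H = 0"
      by (simp add: inner_add_left i h xu xv yu yv)
  qed
  moreover have "br u y - br v x = 0"
  proof (rule zero)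
    fix H assume H: "H \<in> T"
    note h = root_pairD[OF rp H] root_pairD[OF xy H]
    show "br H (br u y - br v x) = 0"
      by (simp add: br_simps jacobi[of H] h)
    show "inner (br u y - br v x) H = 0"
      by (simp add: inner_diff_left i h xu xv yu yv)
  qed
  ultimately have "br v y = - br u x" "br v x = br u y" by (auto simp: add_eq_0_iff)
  then have "inner \<alpha> \<alpha> * inner u u * inner x x = - inner (br u x) (br u x) - inner (br u y) (br u y)"
    using root_pair_jacobi[OF xy] by simp
  then have "inner \<alpha> \<alpha> * inner u u * inner x x \<le> 0"
    by (smt (verit) inner_ge_zero)
  moreover have "inner \<alpha> \<alpha> * inner u u > 0" using \<alpha> u by simp
  ultimately have "inner x x \<le> 0" by (meson mult_pos_pos not_le)
  then show ?thesis by (metis inner_gt_zero_iff not_le)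
qed

end

lemma root_pair_scale: "root_pair \<alpha> u v \<Longrightarrow> root_pair \<alpha> (c *\<^sub>R u) (c *\<^sub>R v)"
  by (simp add: root_pair_def br_simps)

lemma root_pair_uminus: "root_pair \<alpha> u v \<Longrightarrow> root_pair (- \<alpha>) u (- v)"
  by (simp add: root_pair_def br_simps)

lemma root_pair_rotate: "root_pair \<alpha> u v \<Longrightarrow> root_pair \<alpha> v (- u)"
  by (simp add: root_pair_def br_simps)

text \<open>Eigenvectors of commuting skew operators for different eigenvalues. In real terms,
  invariance under \<open>\<alpha> + \<beta>\<close> and \<open>\<alpha> - \<beta>\<close>, both
  nonzero elements of \<open>T\<close>, makes \<open>inner u x\<close> equal to both
  \<open>inner v y\<close> and its negative.\<close>

lemma root_pairs_orth:
  assumes \<alpha>: "\<alpha> \<in> T" and \<beta>: "\<beta> \<in> T" and ne: "\<alpha> \<noteq> \<beta>" "\<alpha> \<noteq> - \<beta>"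
    and uv: "root_pair \<alpha> u v" and xy: "root_pair \<beta> x y"
  shows "inner u x = 0"
proof -
  have c: "inner (\<alpha> + \<beta>) H * (inner u x - inner v y) = 0 \<and> inner (\<alpha> - \<beta>) H * (inner u x + inner v y) = 0"
    if "H \<in> T" for H
  proof -
    note h = root_pairD[OF uv that] root_pairD[OF xy that]
    have "inner (br H u) y = - inner u (br H y)" "inner (br H v) x = - inner v (br H x)"
      by (rule inner_br)+
    then show ?thesis by (simp add: h inner_add_left inner_diff_left algebra_simps)
  qed
  have "\<alpha> + \<beta> \<in> T" "\<alpha> - \<beta> \<in> T" using \<alpha> \<beta> T_subspace by (auto simp: subspace_add subspace_diff)
  from c[OF this(1)] c[OF this(2)] show ?thesis using ne by (auto simp: eq_neg_iff_add_eq_0)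
qed

end

text \<open>Both sums contract \<open>\<beta>\<close> with the matrix of \<open>J\<close>, once
  transposed, and that matrix is skew.\<close>

lemma sum_Basis_skew:
  fixes J :: "'a::euclidean_space \<Rightarrow> 'a" and \<beta> :: "'a \<Rightarrow> 'a \<Rightarrow> real"
  assumes \<beta>: "bilinear \<beta>" and skew: "\<And>x y. inner (J x) y = - inner x (J y)"
  shows "(\<Sum>e\<in>Basis. \<beta> (J e) e) = - (\<Sum>e\<in>Basis. \<beta> e (J e))"
proof -
  have l: "\<beta> x y = (\<Sum>f\<in>Basis. inner x f * \<beta> f y)" for x y
  proof -
    have "\<beta> x y = \<beta> (\<Sum>f\<in>Basis. inner x f *\<^sub>R f) y" by (simp add: euclidean_representation)
    also have "\<dots> = (\<Sum>f\<in>Basis. \<beta> (inner x f *\<^sub>R f) y)"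
      by (rule linear_sum) (use \<beta> in \<open>simp add: bilinear_def\<close>)
    also have "\<dots> = (\<Sum>f\<in>Basis. inner x f * \<beta> f y)" by (simp add: bilinear_lmul[OF \<beta>])
    finally show ?thesis .
  qed
  have r: "\<beta> x y = (\<Sum>f\<in>Basis. inner y f * \<beta> x f)" for x y
  proof -
    have "\<beta> x y = \<beta> x (\<Sum>f\<in>Basis. inner y f *\<^sub>R f)" by (simp add: euclidean_representation)
    also have "\<dots> = (\<Sum>f\<in>Basis. \<beta> x (inner y f *\<^sub>R f))"
      by (rule linear_sum) (use \<beta> in \<open>simp add: bilinear_def\<close>)
    also have "\<dots> = (\<Sum>f\<in>Basis. inner y f * \<beta> x f)" by (simp add: bilinear_rmul[OF \<beta>])
    finally show ?thesis .
  qed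
  have "(\<Sum>e\<in>Basis. \<beta> (J e) e) = (\<Sum>e\<in>Basis. \<Sum>f\<in>Basis. inner (J e) f * \<beta> f e)"
    by (intro sum.cong refl l)
  also have "\<dots> = (\<Sum>f\<in>Basis. \<Sum>e\<in>Basis. inner (J e) f * \<beta> f e)"
    by (rule sum.swap)
  also have "\<dots> = (\<Sum>f\<in>Basis. \<Sum>e\<in>Basis. - (inner (J f) e * \<beta> f e))"
  proof (intro sum.cong refl)
    fix e f
    show "inner (J e) f * \<beta> f e = - (inner (J f) e * \<beta> f e)"
      unfolding skew[of e f] by (simp add: inner_commute)
  qed
  also have "\<dots> = - (\<Sum>f\<in>Basis. \<Sum>e\<in>Basis. inner (J f) e * \<beta> f e)"
    by (simp only: sum_negf)
  also have "\<dots> = - (\<Sum>f\<in>Basis. \<beta> f (J f))"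
    by (intro arg_cong[where f=uminus] sum.cong refl r[symmetric])
  finally show ?thesis .
qed

section \<open>An orthonormal frame of root vectors for the positive roots\<close>

locale root_frame = compact_lie_torus br T
  for br :: "'g::euclidean_space \<Rightarrow> 'g \<Rightarrow> 'g" and T +
  fixes P :: "'g set" and w :: 'g and u v :: "'g \<Rightarrow> 'g"
  assumes w: "w \<in> T" and regular: "\<alpha> \<in> roots br T \<Longrightarrow> inner \<alpha> w \<noteq> 0"
    and P_def: "P = {\<alpha> \<in> roots br T. inner \<alpha> w > 0}"
    and u_norm: "\<alpha> \<in> P \<Longrightarrow> norm (u \<alpha>) = 1"
    and uv: "\<alpha> \<in> P \<Longrightarrow> root_pair \<alpha> (u \<alpha>) (v \<alpha>)"
begin

lemma P_T: "\<alpha> \<in> P \<Longrightarrow> \<alpha> \<in> T" and P_nz: "\<alpha> \<in> P \<Longrightarrow> \<alpha> \<noteq> 0" and P_pos: "\<alpha> \<in> P \<Longrightarrow> inner \<alpha> w > 0"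
  by (auto simp: P_def roots_iff)

lemma P_neg: "\<alpha> \<in> P \<Longrightarrow> \<beta> \<in> P \<Longrightarrow> \<alpha> \<noteq> - \<beta>"
  using P_pos[of \<alpha>] P_pos[of \<beta>] by auto

text \<open>Two positive roots are never opposite, so \<open>root_pairs_orth\<close> covers distinct
  roots. The products involving \<open>v\<close> follow by rotating one or both pairs, since
  \<open>v, - u\<close> is again a root pair.\<close>

lemma uv_inner:
  assumes "\<alpha> \<in> P" "\<beta> \<in> P"
  shows "inner (u \<alpha>) (u \<beta>) = (if \<alpha> = \<beta> then 1 else 0)"
    "inner (v \<alpha>) (v \<beta>) = (if \<alpha> = \<beta> then 1 else 0)"
    "inner (u \<alpha>) (v \<beta>) = 0" "inner (v \<alpha>) (u \<beta>) = 0"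
proof -
  have 1: "inner (u \<alpha>) (u \<alpha>) = 1" using assms u_norm by (simp add: norm_eq_1)
  note o = root_pair_norm[OF P_T P_nz uv, OF assms(1) assms(1) assms(1)]
    root_pair_orth[OF P_T P_nz uv, OF assms(1) assms(1) assms(1)]
  note d = root_pairs_orth[OF P_T[OF assms(1)] P_T[OF assms(2)] _ P_neg[OF assms]]
  note uv = uv[OF assms(1)] uv[OF assms(2)]
  show "inner (u \<alpha>) (u \<beta>) = (if \<alpha> = \<beta> then 1 else 0)"
    using 1 d uv by auto
  show "inner (v \<alpha>) (v \<beta>) = (if \<alpha> = \<beta> then 1 else 0)"
    using 1 o d[OF _ uv[THEN root_pair_rotate]] by auto
  show "inner (u \<alpha>) (v \<beta>) = 0"
    using o d[OF _ uv(1) uv(2)[THEN root_pair_rotate]] by auto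
  show "inner (v \<alpha>) (u \<beta>) = 0"
    using o d[OF _ uv(1)[THEN root_pair_rotate] uv(2)] by (auto simp: inner_commute)
qed

lemma uv_perp_T:
  assumes "\<alpha> \<in> P" "H \<in> T"
  shows "inner (u \<alpha>) H = 0" "inner (v \<alpha>) H = 0" "inner H (u \<alpha>) = 0" "inner H (v \<alpha>) = 0"
  using root_pair_perp_T[OF P_T P_nz uv assms(2), OF assms(1) assms(1) assms(1)]
  by (simp_all add: inner_commute)

lemma finite_P: "finite P"
proof -
  have "pairwise orthogonal (u ` P)"
    by (auto simp: pairwise_def orthogonal_def uv_inner)
  then have "finite (u ` P)" by (rule pairwise_orthogonal_imp_finite)
  moreover have "inj_on u P"
    by (rule inj_onI) (metis uv_inner(1) zero_neq_one)
  ultimately show ?thesis by (simp add: finite_image_iff)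
qed

text \<open>Otherwise the orthogonal complement of the frame is nonzero, stable under the torus and
  orthogonal to it, so it contains a vector of a root pair. Its root or the negative is positive,
  and \<open>root_space_one_dim\<close> makes that vector zero.\<close>

lemma span_frame: "span (T \<union> u ` P \<union> v ` P) = UNIV"
proof (rule ccontr)
  define B where "B = T \<union> u ` P \<union> v ` P"
  define U where "U = {x. \<forall>b\<in>B. inner x b = 0}"
  assume "span (T \<union> u ` P \<union> v ` P) \<noteq> UNIV"
  then obtain x where x: "x \<noteq> 0" "\<forall>y\<in>span B. inner x y = 0"
    using span_not_UNIV_orthogonal[of B] by (auto simp: B_def)
  then have "x \<in> U" by (simp add: U_def span_base)
  then have nz: "U \<noteq> {0}" using x by auto
  have sub: "subspace U" by (auto simp: U_def subspace_def inner_add_left)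
  have perp: "inner x H = 0" if "H \<in> T" "x \<in> U" for x H
    using that by (simp add: U_def B_def)
  have "br H x \<in> U" if H: "H \<in> T" and x: "x \<in> U" for H x
    unfolding U_def
  proof (intro CollectI ballI)
    fix b assume "b \<in> B"
    then have "inner x (br H b) = 0"
    proof (unfold B_def, elim UnE imageE)
      assume "b \<in> T"
      then show ?thesis using H by (simp add: T_abelian)
    next
      fix \<alpha> assume "b = u \<alpha>" "\<alpha> \<in> P"
      then show ?thesis using root_pairD[OF uv H] x by (simp add: U_def B_def)
    next
      fix \<alpha> assume "b = v \<alpha>" "\<alpha> \<in> P"
      then show ?thesis using root_pairD[OF uv H] x by (simp add: U_def B_def)
    qed
    then show "inner (br H x) b = 0" by (simp add: inner_br)
  qed
  from exists_root_pair[OF sub nz this perp]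
  obtain \<alpha> x y where \<alpha>: "\<alpha> \<in> T" "\<alpha> \<noteq> 0" and x: "x \<in> U" "x \<noteq> 0" and xy: "root_pair \<alpha> x y"
    by metis
  have "x = 0" if "\<beta> \<in> P" "root_pair \<beta> x z" for \<beta> z
  proof -
    have "u \<beta> \<noteq> 0" using u_norm[OF that(1)] by auto
    then show ?thesis
      using root_space_one_dim[OF P_T P_nz uv _ that(2), OF that(1) that(1) that(1)] x that
      by (simp add: U_def B_def)
  qed
  moreover have "\<alpha> \<in> P \<or> - \<alpha> \<in> P"
  proof -
    have "\<alpha> \<in> roots br T" using \<alpha> x xy by (auto simp: roots_iff)
    moreover from this have "- \<alpha> \<in> roots br T"
      using \<alpha> x root_pair_uminus[OF xy] T_subspace by (auto simp: roots_iff subspace_neg)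
    ultimately show ?thesis using regular[of \<alpha>] by (auto simp: P_def)
  qed
  ultimately show False using x xy root_pair_uminus[OF xy] by blast
qed

section \<open>The complex structure of the positive roots\<close>

definition J :: "'g \<Rightarrow> 'g" where
  "J x = (\<Sum>\<alpha>\<in>P. inner x (u \<alpha>) *\<^sub>R v \<alpha> - inner x (v \<alpha>) *\<^sub>R u \<alpha>)"

lemma J_linear: "linear J"
  by (rule linearI)
    (simp_all add: J_def inner_add_left algebra_simps sum.distrib sum_subtractf scaleR_sum_right)

lemma J_skew: "inner (J x) y = - inner x (J y)"
  by (simp add: J_def inner_sum_left inner_sum_right inner_diff_left inner_diff_right
      sum_negf[symmetric] inner_commute mult.commute)

lemma J_T: "H \<in> T \<Longrightarrow> J H = 0"
  by (simp add: J_def uv_perp_T)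

lemma J_u: "\<alpha> \<in> P \<Longrightarrow> J (u \<alpha>) = v \<alpha>"
  and J_v: "\<alpha> \<in> P \<Longrightarrow> J (v \<alpha>) = - u \<alpha>"
  using finite_P
  by (simp_all add: J_def uv_inner if_distrib[of "\<lambda>c. c *\<^sub>R _"] sum_negf cong: if_cong)

text \<open>Tested on the spanning frame: \<open>T\<close> is orthogonal to both terms, and on each
  root plane \<open>J\<close> is a quarter turn.\<close>

lemma J_J:
  assumes "\<And>H. H \<in> T \<Longrightarrow> inner x H = 0"
  shows "J (J x) = - x"
proof -
  have "inner (J (J x) + x) b = 0" if "b \<in> T \<union> u ` P \<union> v ` P" for b
    using that assms
    by (auto simp: inner_add_left J_skew J_T J_u J_v linear_neg[OF J_linear]
        linear_0[OF J_linear] uv_inner)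
  then have "orthogonal (J (J x) + x) y" for y
    using orthogonal_to_span[of y "T \<union> u ` P \<union> v ` P" "J (J x) + x"]
    by (simp add: span_frame orthogonal_def)
  then have "J (J x) + x = 0" using orthogonal_self by blast
  then show ?thesis by (simp add: eq_neg_iff_add_eq_0)
qed

text \<open>On each root plane \<open>br H\<close> is a multiple of \<open>J\<close>, and on
  \<open>T\<close> both sides vanish.\<close>

lemma ad_T_J:
  assumes H: "H \<in> T"
  shows "br H (J x) = J (br H x)"
proof -
  have "br H (J b) = J (br H b)" if "b \<in> T \<union> u ` P \<union> v ` P" for b
    using that root_pairD[OF uv H]
    by (auto simp: J_T J_u J_v T_abelian H br_simps linear_neg[OF J_linear] linear_scale[OF J_linear]
      linear_0[OF J_linear])
  moreover have "linear (\<lambda>x. br H (J x))" "linear (\<lambda>x. J (br H x))"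
    using linear_compose[OF J_linear br_linear] linear_compose[OF br_linear J_linear]
    by (simp_all add: o_def)
  ultimately show ?thesis
    using linear_eq_on_span[of "\<lambda>x. br H (J x)" "\<lambda>x. J (br H x)" "T \<union> u ` P \<union> v ` P" x]
    by (simp add: span_frame)
qed

section \<open>The invariant 3-form and its (3,0) part\<close>

definition \<psi> :: "'g \<Rightarrow> 'g \<Rightarrow> 'g \<Rightarrow> real" where
  "\<psi> x y z = inner (br x y) z"

text \<open>With \<open>\<psi>\<close> extended complex trilinearly, this is the real part of
  \<open>\<psi>\<close> at x - i J x, y - i J y, z - i J z, so on the root planes a multiple of the
  real part of its (3,0) component.\<close>

definition F :: "'g \<Rightarrow> 'g \<Rightarrow> 'g \<Rightarrow> real" where
  "F x y z = \<psi> x y z - \<psi> (J x) (J y) z - \<psi> (J x) y (J z) - \<psi> x (J y) (J z)"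

lemma \<psi>_cyc: "\<psi> x y z = \<psi> y z x"
  unfolding \<psi>_def by (subst inner_br_cyc) (rule inner_commute)

lemma F_cyc: "F x y z = F y z x"
  unfolding F_def using \<psi>_cyc by (smt (verit))

lemma F_linear: "linear (\<lambda>x. F x y z)"
  by (rule linearI)
    (simp_all add: F_def \<psi>_def br_simps linear_add[OF J_linear] linear_scale[OF J_linear]
      inner_add_left algebra_simps)

lemma \<psi>_invariant: "\<psi> (br a x) y z + \<psi> x (br a y) z + \<psi> x y (br a z) = 0"
proof -
  have "inner (br a (br x y)) z = - inner (br x y) (br a z)" by (rule inner_br)
  then show ?thesis by (simp add: \<psi>_def jacobi[of a x y] inner_add_left)
qed

text \<open>Only \<open>\<psi> x y z\<close> and \<open>\<psi> x (J y) (J z)\<close> survive. They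
  agree because \<open>br x\<close> commutes with \<open>J\<close> and has its image orthogonal to
  \<open>T\<close>, where \<open>J\<close> is an isometry.\<close>

lemma F_T:
  assumes x: "x \<in> T"
  shows "F x y z = 0"
proof -
  have "inner (br x y) H = 0" if "H \<in> T" for H
    using T_abelian[OF x that] by (simp add: inner_br)
  then have "J (J (br x y)) = - br x y" by (rule J_J)
  then have "inner (J (br x y)) (J z) = inner (br x y) z"
    using J_skew[of "J (br x y)" z] by simp
  then show ?thesis
    by (simp add: F_def \<psi>_def J_T[OF x] br_simps ad_T_J[OF x])
qed

text \<open>On the positive root spaces \<open>ad w = - \<lambda> J\<close> with \<open>\<lambda> > 0\<close>, so invariance of \<open>\<psi>\<close>
  under \<open>w\<close> multiplies its \<open>(3,0)\<close> part by \<open>\<lambda>\<^sub>x + \<lambda>\<^sub>y + \<lambda>\<^sub>z \<noteq> 0\<close>.\<close>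

lemma F_root:
  assumes "x \<in> u ` P \<union> v ` P" "y \<in> u ` P \<union> v ` P" "z \<in> u ` P \<union> v ` P"
  shows "F x y z = 0"
proof -
  have "\<exists>l>0. br w x = - l *\<^sub>R J x \<and> br w (J x) = l *\<^sub>R x" if x: "x \<in> u ` P \<union> v ` P" for x
  proof -
    obtain \<alpha> where \<alpha>: "\<alpha> \<in> P" "x = u \<alpha> \<or> x = v \<alpha>" using x by blast
    then have "br w x = - inner \<alpha> w *\<^sub>R J x \<and> br w (J x) = inner \<alpha> w *\<^sub>R x"
      using root_pairD[OF uv w, of \<alpha>] by (auto simp: J_u J_v br_simps)
    then show ?thesis using P_pos \<alpha> by blast
  qed
  then obtain a b c where abc: "a > 0" "b > 0" "c > 0"
    and r: "br w x = - a *\<^sub>R J x" "br w (J x) = a *\<^sub>R x"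
      "br w y = - b *\<^sub>R J y" "br w (J y) = b *\<^sub>R y"
      "br w z = - c *\<^sub>R J z" "br w (J z) = c *\<^sub>R z"
    using assms by metis
  have s: "\<psi> (k *\<^sub>R x) y z = k * \<psi> x y z" "\<psi> x (k *\<^sub>R y) z = k * \<psi> x y z"
    "\<psi> x y (k *\<^sub>R z) = k * \<psi> x y z" for k x y z
    by (simp_all add: \<psi>_def br_simps)
  have "a * \<psi> x y z - b * \<psi> (J x) (J y) z - c * \<psi> (J x) y (J z) = 0"
    using \<psi>_invariant[of w "J x" y z] by (simp only: r s)
  moreover have "- a * \<psi> (J x) (J y) z + b * \<psi> x y z - c * \<psi> x (J y) (J z) = 0"
    using \<psi>_invariant[of w x "J y" z] by (simp only: r s)
  moreover have "- a * \<psi> (J x) y (J z) - b * \<psi> x (J y) (J z) + c * \<psi> x y z = 0"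
    using \<psi>_invariant[of w x y "J z"] by (simp only: r s)
  moreover have "a * \<psi> x (J y) (J z) + b * \<psi> (J x) y (J z) + c * \<psi> (J x) (J y) z = 0"
    using \<psi>_invariant[of w "J x" "J y" "J z"] by (simp only: r s)
  \<comment> \<open>The first three equations added up, minus the fourth.\<close>
  ultimately have "(a + b + c) * F x y z = 0" unfolding F_def by algebra
  then show ?thesis using abc by auto
qed

text \<open>Linearity in the first slot extends the vanishing from root vectors to all vectors,
  torus vectors being covered by \<open>F_T\<close>; cyclicity brings each slot to the front in
  turn.\<close>

lemma F_zero: "F x y z = 0"
proof -
  define R where "R = u ` P \<union> v ` P"
  have span: "span (T \<union> R) = UNIV" using span_frame by (simp add: R_def Un_assoc)
  have ext: "F x y z = 0" if "\<And>b. b \<in> R \<Longrightarrow> F b y z = 0" for x y z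
    using linear_eq_0_on_span[OF F_linear, of "T \<union> R" y z x] that F_T span by auto
  have 2: "F x y z = 0" if "y \<in> R" "z \<in> R" for x y z
    by (rule ext) (use that in \<open>simp add: F_root R_def\<close>)
  have 3: "F x y z = 0" if z: "z \<in> R" for x y z
  proof -
    have "F b z x = 0" if "b \<in> R" for b
      using 2[OF that z] F_cyc[of x b z] F_cyc[of b z x] by simp
    then show ?thesis by (subst F_cyc) (rule ext)
  qed
  have "F b x y = 0" if "b \<in> R" for b
    using 3[OF that] F_cyc[of b x y] by simp
  then have "F z x y = 0" by (rule ext)
  then show ?thesis by (simp only: F_cyc[of z x y])
qed

section \<open>Contractions of the 3-form and the Weyl vector\<close>

lemma sum_bracket_J: "(\<Sum>e\<in>Basis. br e (J e)) = - 4 *\<^sub>R weyl_vector P"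
proof -
  have t: "(\<Sum>e\<in>Basis. inner e x *\<^sub>R br e y) = br x y" for x y
  proof -
    have "br x y = br (\<Sum>e\<in>Basis. inner x e *\<^sub>R e) y" by (simp add: euclidean_representation)
    also have "\<dots> = (\<Sum>e\<in>Basis. inner x e *\<^sub>R br e y)"
      by (simp add: linear_sum[OF br_linear_left] br_simps)
    finally show ?thesis by (simp add: inner_commute)
  qed
  have "(\<Sum>e\<in>Basis. br e (J e)) =
      (\<Sum>e\<in>Basis. \<Sum>\<alpha>\<in>P. inner e (u \<alpha>) *\<^sub>R br e (v \<alpha>) - inner e (v \<alpha>) *\<^sub>R br e (u \<alpha>))"
    by (simp add: J_def linear_sum[OF br_linear] br_simps)
  also have "\<dots> = (\<Sum>\<alpha>\<in>P. br (u \<alpha>) (v \<alpha>) - br (v \<alpha>) (u \<alpha>))"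
    by (subst sum.swap) (simp add: sum_subtractf t)
  \<comment> \<open>By \<open>root_pair_bracket\<close> a pair of unit vectors has bracket
    \<open>- \<alpha>\<close>, and the positive roots add up to twice the Weyl vector.\<close>
  also have "\<dots> = (\<Sum>\<alpha>\<in>P. - 2 *\<^sub>R \<alpha>)"
  proof (rule sum.cong[OF refl])
    fix \<alpha> assume "\<alpha> \<in> P"
    then have "br (u \<alpha>) (v \<alpha>) = - \<alpha>"
      using root_pair_bracket[OF P_T P_nz uv] by (simp add: uv_inner)
    then show "br (u \<alpha>) (v \<alpha>) - br (v \<alpha>) (u \<alpha>) = - 2 *\<^sub>R \<alpha>"
      using br_anti[of "v \<alpha>" "u \<alpha>"] by (simp add: scaleR_2)
  qed
  also have "\<dots> = - 4 *\<^sub>R weyl_vector P"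
    by (simp add: weyl_vector_def scaleR_sum_right)
  finally show ?thesis .
qed

text \<open>Pairing \<open>sum_bracket_J\<close> with itself gives 16 |\<rho>|^2. The Jacobi
  identity splits each summand in two, and \<open>sum_Basis_skew\<close> shows that both parts have
  the same sum.\<close>

lemma norm_weyl_vector:
  "(\<Sum>e\<in>Basis. \<Sum>f\<in>Basis. inner (br e f) (br (J e) (J f))) = 8 * (norm (weyl_vector P))\<^sup>2"
    (is "?Z = _")
proof -
  have j: "inner (br e (J e)) (br f (J f)) =
      inner (br e f) (br (J e) (J f)) - inner (br (J e) f) (br e (J f))" for e f
  proof -
    have "inner (br e (J e)) (br f (J f)) = inner (br (br e (J e)) f) (J f)"
      by (rule inner_br_cyc[symmetric])
    also have "br (br e (J e)) f = br e (br (J e) f) - br (J e) (br e f)"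
      by (simp add: jacobi[of e "J e" f])
    finally show ?thesis by (simp add: inner_diff_left inner_br)
  qed
  have s: "(\<Sum>e\<in>Basis. inner (br (J e) f) (br e (J f))) =
      - (\<Sum>e\<in>Basis. inner (br e f) (br (J e) (J f)))" for f
    by (rule sum_Basis_skew[OF _ J_skew])
      (auto intro!: linearI simp: bilinear_def br_simps inner_add_left inner_add_right)
  have "16 * (norm (weyl_vector P))\<^sup>2 = inner (\<Sum>e\<in>Basis. br e (J e)) (\<Sum>f\<in>Basis. br f (J f))"
    by (simp add: sum_bracket_J power2_norm_eq_inner)
  also have "\<dots> = (\<Sum>f\<in>Basis. \<Sum>e\<in>Basis. inner (br e (J e)) (br f (J f)))"
    unfolding inner_sum_left inner_sum_right by (rule refl | rule sum.swap)
  also have "\<dots> = 2 * (\<Sum>f\<in>Basis. \<Sum>e\<in>Basis. inner (br e f) (br (J e) (J f)))"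
    by (simp add: j sum_subtractf s sum_negf sum_distrib_left)
  also have "(\<Sum>f\<in>Basis. \<Sum>e\<in>Basis. inner (br e f) (br (J e) (J f))) = ?Z" by (rule sum.swap)
  finally show ?thesis by simp
qed

text \<open>Summing \<open>F_zero\<close> against \<open>\<psi>\<close> yields three contractions;
  cyclicity of \<open>\<psi>\<close> and renaming of indices identify each with
  \<open>?Z\<close>.\<close>

lemma sum_bracket_norm:
  "(\<Sum>e\<in>Basis. \<Sum>f\<in>Basis. (norm (br e f))\<^sup>2) =
    3 * (\<Sum>e\<in>Basis. \<Sum>f\<in>Basis. inner (br e f) (br (J e) (J f)))" (is "_ = 3 * ?Z")
proof -
  have sq: "inner a b = (\<Sum>g\<in>Basis. inner a g * inner b g)" for a b :: 'g
    by (rule euclidean_inner)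
  have c: "\<psi> x y z = inner (br z x) y" for x y z
    by (subst \<psi>_cyc, subst \<psi>_cyc) (simp only: \<psi>_def)
  have d: "\<psi> x y z = inner (br y z) x" for x y z
    by (subst \<psi>_cyc) (simp only: \<psi>_def)
  have "(\<Sum>e\<in>Basis. \<Sum>f\<in>Basis. (norm (br e f))\<^sup>2) =
      (\<Sum>e\<in>Basis. \<Sum>f\<in>Basis. \<Sum>g\<in>Basis. \<psi> e f g * \<psi> e f g)"
    by (simp only: power2_norm_eq_inner \<psi>_def sq[symmetric])
  also have "\<dots> = (\<Sum>e\<in>Basis. \<Sum>f\<in>Basis. \<Sum>g\<in>Basis. \<psi> e f g * \<psi> (J e) (J f) g) +
      (\<Sum>e\<in>Basis. \<Sum>f\<in>Basis. \<Sum>g\<in>Basis. \<psi> e f g * \<psi> (J e) f (J g)) +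
      (\<Sum>e\<in>Basis. \<Sum>f\<in>Basis. \<Sum>g\<in>Basis. \<psi> e f g * \<psi> e (J f) (J g))"
  proof -
    have "\<psi> x y z * \<psi> x y z = \<psi> x y z * \<psi> (J x) (J y) z + \<psi> x y z * \<psi> (J x) y (J z)
        + \<psi> x y z * \<psi> x (J y) (J z)" for x y z
      using F_zero[of x y z] unfolding F_def by algebra
    then show ?thesis by (simp only: sum.distrib)
  qed
  finally have S: "(\<Sum>e\<in>Basis. \<Sum>f\<in>Basis. (norm (br e f))\<^sup>2) = \<dots>" .
  have Z1: "(\<Sum>e\<in>Basis. \<Sum>f\<in>Basis. \<Sum>g\<in>Basis. \<psi> e f g * \<psi> (J e) (J f) g) = ?Z"
    by (simp only: \<psi>_def sq[symmetric])
  have Z2: "(\<Sum>e\<in>Basis. \<Sum>f\<in>Basis. \<Sum>g\<in>Basis. \<psi> e f g * \<psi> (J e) f (J g)) = ?Z"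
  proof -
    have "(\<Sum>e\<in>Basis. \<Sum>f\<in>Basis. \<Sum>g\<in>Basis. \<psi> e f g * \<psi> (J e) f (J g)) =
        (\<Sum>e\<in>Basis. \<Sum>g\<in>Basis. \<Sum>f\<in>Basis. \<psi> e f g * \<psi> (J e) f (J g))"
      by (rule sum.cong[OF refl]) (rule sum.swap)
    also have "\<dots> = (\<Sum>e\<in>Basis. \<Sum>g\<in>Basis. inner (br g e) (br (J g) (J e)))"
      by (simp only: c sq[symmetric])
    also have "\<dots> = ?Z" by (rule sum.swap)
    finally show ?thesis .
  qed
  have Z3: "(\<Sum>e\<in>Basis. \<Sum>f\<in>Basis. \<Sum>g\<in>Basis. \<psi> e f g * \<psi> e (J f) (J g)) = ?Z"
  proof -
    have "(\<Sum>e\<in>Basis. \<Sum>f\<in>Basis. \<Sum>g\<in>Basis. \<psi> e f g * \<psi> e (J f) (J g)) =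
        (\<Sum>f\<in>Basis. \<Sum>e\<in>Basis. \<Sum>g\<in>Basis. \<psi> e f g * \<psi> e (J f) (J g))"
      by (rule sum.swap)
    also have "\<dots> = (\<Sum>f\<in>Basis. \<Sum>g\<in>Basis. \<Sum>e\<in>Basis. \<psi> e f g * \<psi> e (J f) (J g))"
      by (rule sum.cong[OF refl]) (rule sum.swap)
    finally show ?thesis by (simp only: d sq[symmetric])
  qed
  show ?thesis unfolding S Z1 Z2 Z3 by simp
qed

end

text \<open>The left side is the trace of the Casimir operator in the adjoint representation, since
  summing |[e, f]|^2 over f gives minus the trace of (ad e)^2.\<close>

theorem (in compact_lie_torus) strange_formula:
  assumes "positive_system br T P"
  shows "(\<Sum>e\<in>Basis. \<Sum>f\<in>Basis. (norm (br e f))\<^sup>2) = 24 * (norm (weyl_vector P))\<^sup>2"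
proof -
  obtain w where w: "w \<in> T" "\<And>\<alpha>. \<alpha> \<in> roots br T \<Longrightarrow> inner \<alpha> w \<noteq> 0"
    and P: "P = {\<alpha> \<in> roots br T. inner \<alpha> w > 0}"
    using assms unfolding positive_system_def by blast
  have "\<exists>u v. norm u = 1 \<and> root_pair \<alpha> u v" if "\<alpha> \<in> P" for \<alpha>
  proof -
    obtain u v where \<alpha>: "\<alpha> \<in> T" "\<alpha> \<noteq> 0" and uv: "(u, v) \<noteq> (0, 0)" "root_pair \<alpha> u v"
      using \<open>\<alpha> \<in> P\<close> unfolding P roots_iff by blast
    \<comment> \<open>A root only provides a nonzero pair; as |u| = |v|, neither component vanishes
      and \<open>u\<close> can be normalised.\<close>
    have "u \<noteq> 0" using root_pair_norm[OF \<alpha> uv(2)] uv(1) by auto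
    then show ?thesis
      using root_pair_scale[OF uv(2), of "1 / norm u"]
      by (intro exI[of _ "(1 / norm u) *\<^sub>R u"] exI[of _ "(1 / norm u) *\<^sub>R v"]) simp
  qed
  then obtain u v where uv: "\<And>\<alpha>. \<alpha> \<in> P \<Longrightarrow> norm (u \<alpha>) = 1 \<and> root_pair \<alpha> (u \<alpha>) (v \<alpha>)" by metis
  interpret root_frame br T P w u v
    by unfold_locales (use w P uv in \<open>blast+\<close>)
  show ?thesis unfolding sum_bracket_norm norm_weyl_vector by simp
qed

subsection \<open>The cubic Dirac operator in a quotient algebra\<close>

lemma sum_swap3:
  fixes f :: "'i \<Rightarrow> 'j \<Rightarrow> 'k \<Rightarrow> 'a::comm_monoid_add"
  shows "(\<Sum>i\<in>A. \<Sum>j\<in>B. \<Sum>k\<in>C. f i j k) = (\<Sum>j\<in>B. \<Sum>k\<in>C. \<Sum>i\<in>A. f i j k)"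
  by (subst sum.swap, rule sum.cong[OF refl]) (rule sum.swap)

section \<open>Congruence modulo a two-sided ideal\<close>

locale ideal_cong =
  fixes I :: "'r::real_algebra_1 set"
  assumes I_zero: "0 \<in> I" and I_add: "x \<in> I \<Longrightarrow> y \<in> I \<Longrightarrow> x + y \<in> I"
    and I_lmult: "x \<in> I \<Longrightarrow> a * x \<in> I" and I_rmult: "x \<in> I \<Longrightarrow> x * a \<in> I"
begin

definition cong :: "'r \<Rightarrow> 'r \<Rightarrow> bool" (infix "\<simeq>" 50) where
  "x \<simeq> y \<longleftrightarrow> x - y \<in> I"

lemma I_scaleR: "x \<in> I \<Longrightarrow> r *\<^sub>R x \<in> I"
  using I_lmult[of x "r *\<^sub>R 1"] by simp

lemma I_minus: "x \<in> I \<Longrightarrow> - x \<in> I"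
  using I_scaleR[of x "-1"] by simp

lemma I_diff: "x \<in> I \<Longrightarrow> y \<in> I \<Longrightarrow> x - y \<in> I"
  using I_add[of x "- y"] I_minus by simp

lemma I_sum: "(\<And>i. i \<in> A \<Longrightarrow> f i \<in> I) \<Longrightarrow> sum f A \<in> I"
  by (induction A rule: infinite_finite_induct) (auto simp: I_zero I_add)

lemma cong_refl [simp]: "x \<simeq> x"
  by (simp add: cong_def I_zero)

lemma cong_sym: "x \<simeq> y \<Longrightarrow> y \<simeq> x"
  using I_minus[of "x - y"] by (simp add: cong_def)

lemma cong_trans [trans]: "x \<simeq> y \<Longrightarrow> y \<simeq> z \<Longrightarrow> x \<simeq> z"
  using I_add[of "x - y" "y - z"] by (simp add: cong_def)

lemma eq_cong_trans [trans]: "x = y \<Longrightarrow> y \<simeq> z \<Longrightarrow> x \<simeq> z"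
  and cong_eq_trans [trans]: "x \<simeq> y \<Longrightarrow> y = z \<Longrightarrow> x \<simeq> z"
  by simp_all

lemma cong_add: "a \<simeq> b \<Longrightarrow> x \<simeq> y \<Longrightarrow> a + x \<simeq> b + y"
  using I_add[of "a - b" "x - y"] by (simp add: cong_def algebra_simps)

lemma cong_diff: "a \<simeq> b \<Longrightarrow> x \<simeq> y \<Longrightarrow> a - x \<simeq> b - y"
  using I_diff[of "a - b" "x - y"] by (simp add: cong_def algebra_simps)

lemma cong_scaleR: "x \<simeq> y \<Longrightarrow> r *\<^sub>R x \<simeq> r *\<^sub>R y"
  using I_scaleR[of "x - y" r] by (simp add: cong_def algebra_simps)

lemma cong_minus: "x \<simeq> y \<Longrightarrow> - x \<simeq> - y"
  using cong_scaleR[of x y "-1"] by simp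

lemma cong_lmult: "x \<simeq> y \<Longrightarrow> a * x \<simeq> a * y"
  using I_lmult[of "x - y" a] by (simp add: cong_def algebra_simps)

lemma cong_rmult: "x \<simeq> y \<Longrightarrow> x * a \<simeq> y * a"
  using I_rmult[of "x - y" a] by (simp add: cong_def algebra_simps)

lemma cong_sum: "(\<And>i. i \<in> A \<Longrightarrow> f i \<simeq> g i) \<Longrightarrow> sum f A \<simeq> sum g A"
  using I_sum[of A "\<lambda>i. f i - g i"] by (simp add: cong_def sum_subtractf)

end

text \<open>The algebra Cl(g) (x) U(g) by generators, with equality replaced by congruence.
  \<open>c\<close> holds the totally antisymmetric structure constants in an orthonormal basis,
  \<open>d\<close> is twice the Kronecker delta, and \<open>c_jacobi\<close> is the Jacobi identity
  after contraction.\<close>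

locale clifford_envelope = ideal_cong I for I :: "'r::real_algebra_1 set" +
  fixes n :: nat and e u :: "nat \<Rightarrow> 'r" and c :: "nat \<Rightarrow> nat \<Rightarrow> nat \<Rightarrow> real"
    and d :: "nat \<Rightarrow> nat \<Rightarrow> real"
  defines "d i j \<equiv> if i = j then 2 else 0"
  assumes ee: "i < n \<Longrightarrow> j < n \<Longrightarrow> e i * e j + e j * e i + d i j *\<^sub>R 1 \<in> I"
    and uu: "i < n \<Longrightarrow> j < n \<Longrightarrow> u i * u j - u j * u i \<simeq> (\<Sum>k<n. c k i j *\<^sub>R u k)"
    and eu: "i < n \<Longrightarrow> j < n \<Longrightarrow> e i * u j \<simeq> u j * e i"
    and c_anti1: "c i j k = - c j i k" and c_anti2: "c i j k = - c i k j"
    and c_jacobi: "i < n \<Longrightarrow> j < n \<Longrightarrow> k < n \<Longrightarrow> l < n \<Longrightarrow>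
      (\<Sum>m<n. c m i j * c m k l + c m j k * c m i l + c m k i * c m j l) = 0"
begin

section \<open>The spin elements, the cubic element and its square\<close>

definition P :: "nat \<Rightarrow> 'r" where
  "P i = (1/4) *\<^sub>R (\<Sum>k<n. \<Sum>l<n. c i k l *\<^sub>R (e k * e l))"

definition H :: 'r where
  "H = (1/4) *\<^sub>R (\<Sum>j<n. \<Sum>k<n. \<Sum>l<n. c j k l *\<^sub>R (e j * (e k * e l)))"

definition B :: real where
  "B = (\<Sum>i<n. \<Sum>j<n. \<Sum>k<n. (c i j k)\<^sup>2)"

lemma c_cyc: "c i j k = c j k i"
  using c_anti1[of i j k] c_anti2[of j i k] by simp

lemma sum_d: "j < n \<Longrightarrow> (\<Sum>i<n. d i j *\<^sub>R f i) = 2 *\<^sub>R (f j :: 'a::real_vector)"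
  "j < n \<Longrightarrow> (\<Sum>i<n. d j i *\<^sub>R f i) = 2 *\<^sub>R (f j :: 'a::real_vector)"
  by (simp_all add: d_def if_distrib[of "\<lambda>r. r *\<^sub>R _"] cong: if_cong)

text \<open>Carrying \<open>e j\<close> through two factors uses two Clifford relators; the ring
  identity in the proof is the explicit combination.\<close>

lemma ee_e:
  assumes "j < n" "k < n" "l < n"
  shows "e k * e l * e j - e j * (e k * e l) \<simeq> d k j *\<^sub>R e l - d l j *\<^sub>R e k"
proof -
  have "e k * e l * e j - e j * (e k * e l) - (d k j *\<^sub>R e l - d l j *\<^sub>R e k) =
      e k * (e l * e j + e j * e l + d l j *\<^sub>R 1) - (e k * e j + e j * e k + d k j *\<^sub>R 1) * e l"
    by (simp add: algebra_simps)
  then show ?thesis using assms by (simp add: cong_def I_diff I_lmult I_rmult ee)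
qed

text \<open>\<open>e i\<close> passes three factors, each leaving a contraction of alternating sign.
  The number of factors is odd, so it is the anticommutator that drops in degree.\<close>

lemma e_eee:
  assumes "i < n" "j < n" "k < n" "l < n"
  shows "e i * (e j * (e k * e l)) + e j * (e k * e l) * e i \<simeq>
    d i k *\<^sub>R (e j * e l) - d i j *\<^sub>R (e k * e l) - d i l *\<^sub>R (e j * e k)"
proof -
  have "e i * (e j * (e k * e l)) + e j * (e k * e l) * e i -
      (d i k *\<^sub>R (e j * e l) - d i j *\<^sub>R (e k * e l) - d i l *\<^sub>R (e j * e k)) =
      (e i * e j + e j * e i + d i j *\<^sub>R 1) * (e k * e l)
      - e j * (e i * e k + e k * e i + d i k *\<^sub>R 1) * e l
      + e j * (e k * (e i * e l + e l * e i + d i l *\<^sub>R 1))"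
    by (simp add: algebra_simps)
  then show ?thesis using assms by (simp add: cong_def I_add I_diff I_lmult I_rmult ee)
qed

text \<open>The two contractions agree by antisymmetry of \<open>c\<close> and contribute one half
  each. The right side is [X_i, X_j] in coordinates: \<open>P i\<close> acts on the generators by
  the adjoint representation.\<close>

lemma P_e:
  assumes i: "i < n" and j: "j < n"
  shows "P i * e j - e j * P i \<simeq> (\<Sum>l<n. c i j l *\<^sub>R e l)"
proof -
  have "P i * e j - e j * P i =
      (1/4) *\<^sub>R (\<Sum>k<n. \<Sum>l<n. c i k l *\<^sub>R (e k * e l * e j - e j * (e k * e l)))"
    by (simp add: P_def sum_distrib_left sum_distrib_right scaleR_diff_right sum_subtractf)
  also have "\<dots> \<simeq> (1/4) *\<^sub>R (\<Sum>k<n. \<Sum>l<n. c i k l *\<^sub>R (d k j *\<^sub>R e l - d l j *\<^sub>R e k))"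
    by (intro cong_scaleR cong_sum ee_e) (use j in auto)
  also have "\<dots> = (1/4) *\<^sub>R ((\<Sum>l<n. \<Sum>k<n. d k j *\<^sub>R (c i k l *\<^sub>R e l)) -
      (\<Sum>k<n. \<Sum>l<n. d l j *\<^sub>R (c i k l *\<^sub>R e k)))"
    by (subst (2) sum.swap) (simp add: scaleR_diff_right sum_subtractf mult.commute)
  also have "\<dots> = (1/4) *\<^sub>R ((\<Sum>l<n. 2 *\<^sub>R (c i j l *\<^sub>R e l)) - (\<Sum>k<n. 2 *\<^sub>R (c i k j *\<^sub>R e k)))"
    using j by (simp only: sum_d)
  also have "\<dots> = (1/4) *\<^sub>R (\<Sum>l<n. 4 *\<^sub>R (c i j l *\<^sub>R e l))"
    by (simp add: c_anti2[of i _ j] flip: sum_subtractf scaleR_add_left)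
  also have "\<dots> = (\<Sum>l<n. c i j l *\<^sub>R e l)" by (simp add: scaleR_sum_right)
  finally show ?thesis .
qed

text \<open>Total antisymmetry of \<open>c\<close> makes the three contractions equal; each
  contributes \<open>- 2 *\<^sub>R P i\<close>.\<close>

lemma e_H:
  assumes i: "i < n"
  shows "e i * H + H * e i \<simeq> - 6 *\<^sub>R P i"
proof -
  have "e i * H + H * e i = (1/4) *\<^sub>R (\<Sum>j<n. \<Sum>k<n. \<Sum>l<n.
      c j k l *\<^sub>R (e i * (e j * (e k * e l)) + e j * (e k * e l) * e i))"
    by (simp add: H_def sum_distrib_left sum_distrib_right scaleR_add_right sum.distrib)
  also have "\<dots> \<simeq> (1/4) *\<^sub>R (\<Sum>j<n. \<Sum>k<n. \<Sum>l<n.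
      c j k l *\<^sub>R (d i k *\<^sub>R (e j * e l) - d i j *\<^sub>R (e k * e l) - d i l *\<^sub>R (e j * e k)))"
    by (intro cong_scaleR cong_sum e_eee) (use i in auto)
  also have "\<dots> = (1/4) *\<^sub>R (
      (\<Sum>j<n. \<Sum>k<n. \<Sum>l<n. d i k *\<^sub>R (c j k l *\<^sub>R (e j * e l)))
      - (\<Sum>j<n. \<Sum>k<n. \<Sum>l<n. d i j *\<^sub>R (c j k l *\<^sub>R (e k * e l)))
      - (\<Sum>j<n. \<Sum>k<n. \<Sum>l<n. d i l *\<^sub>R (c j k l *\<^sub>R (e j * e k))))"
    by (simp add: scaleR_diff_right sum_subtractf mult.commute)
  also have "(\<Sum>j<n. \<Sum>k<n. \<Sum>l<n. d i k *\<^sub>R (c j k l *\<^sub>R (e j * e l))) =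
      (\<Sum>j<n. \<Sum>l<n. 2 *\<^sub>R (c j i l *\<^sub>R (e j * e l)))"
    by (rule sum.cong[OF refl], subst sum.swap) (use i in \<open>simp only: sum_d\<close>)
  also have "(\<Sum>j<n. \<Sum>k<n. \<Sum>l<n. d i j *\<^sub>R (c j k l *\<^sub>R (e k * e l))) =
      (\<Sum>k<n. \<Sum>l<n. 2 *\<^sub>R (c i k l *\<^sub>R (e k * e l)))"
    using i by (simp only: sum_d flip: scaleR_sum_right)
  also have "(\<Sum>j<n. \<Sum>k<n. \<Sum>l<n. d i l *\<^sub>R (c j k l *\<^sub>R (e j * e k))) =
      (\<Sum>j<n. \<Sum>k<n. 2 *\<^sub>R (c j k i *\<^sub>R (e j * e k)))"
    using i by (simp only: sum_d)
  also have "(1/4) *\<^sub>R ((\<Sum>j<n. \<Sum>l<n. 2 *\<^sub>R (c j i l *\<^sub>R (e j * e l)))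
      - (\<Sum>k<n. \<Sum>l<n. 2 *\<^sub>R (c i k l *\<^sub>R (e k * e l)))
      - (\<Sum>j<n. \<Sum>k<n. 2 *\<^sub>R (c j k i *\<^sub>R (e j * e k)))) =
      (1/4) *\<^sub>R (\<Sum>k<n. \<Sum>l<n. (- 6) *\<^sub>R (c i k l *\<^sub>R (e k * e l)))"
  proof -
    have "2 *\<^sub>R (c k i l *\<^sub>R x) - 2 *\<^sub>R (c i k l *\<^sub>R x) - 2 *\<^sub>R (c k l i *\<^sub>R x) =
        (- 6) *\<^sub>R (c i k l *\<^sub>R x)" for k l and x :: 'r
      unfolding c_anti1[of k i l] c_cyc[of i k l] by (simp flip: scaleR_diff_left scaleR_minus_left)
    then show ?thesis by (simp only: sum_subtractf[symmetric])
  qed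
  also have "\<dots> = - 6 *\<^sub>R P i" by (simp add: P_def scaleR_sum_right)
  finally show ?thesis .
qed

lemma H_eq: "H = (\<Sum>i<n. e i * P i)"
  by (simp add: H_def P_def sum_distrib_left scaleR_sum_right)

text \<open>The commutator with \<open>P i\<close> is a derivation acting on each generator by
  \<open>P_e\<close>. The coefficient of \<open>e a * e b\<close> is then two products of structure
  constants, which the Jacobi identity merges into one.\<close>

lemma P_P:
  assumes i: "i < n" and j: "j < n"
  shows "P i * P j - P j * P i \<simeq> (\<Sum>k<n. c k i j *\<^sub>R P k)"
proof -
  have "P i * P j - P j * P i = (1/4) *\<^sub>R (\<Sum>k<n. \<Sum>l<n.
      c j k l *\<^sub>R ((P i * e k - e k * P i) * e l + e k * (P i * e l - e l * P i)))"
    unfolding P_def[of j]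
    by (simp add: sum_distrib_left sum_distrib_right algebra_simps sum_subtractf)
  also have "\<dots> \<simeq> (1/4) *\<^sub>R (\<Sum>k<n. \<Sum>l<n.
      c j k l *\<^sub>R ((\<Sum>m<n. c i k m *\<^sub>R e m) * e l + e k * (\<Sum>m<n. c i l m *\<^sub>R e m)))"
    by (intro cong_scaleR cong_sum cong_add cong_lmult cong_rmult P_e) (use i in auto)
  also have "\<dots> = (1/4) *\<^sub>R ((\<Sum>k<n. \<Sum>l<n. \<Sum>m<n. (c j k l * c i k m) *\<^sub>R (e m * e l)) +
      (\<Sum>k<n. \<Sum>l<n. \<Sum>m<n. (c j k l * c i l m) *\<^sub>R (e k * e m)))"
    by (simp add: sum_distrib_left sum_distrib_right scaleR_add_right sum.distrib scaleR_sum_right)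
  also have "(\<Sum>k<n. \<Sum>l<n. \<Sum>m<n. (c j k l * c i k m) *\<^sub>R (e m * e l)) =
      (\<Sum>m<n. \<Sum>l<n. \<Sum>k<n. (c j k l * c i k m) *\<^sub>R (e m * e l))"
  proof -
    have "(\<Sum>k<n. \<Sum>l<n. \<Sum>m<n. (c j k l * c i k m) *\<^sub>R (e m * e l)) =
        (\<Sum>k<n. \<Sum>m<n. \<Sum>l<n. (c j k l * c i k m) *\<^sub>R (e m * e l))"
      by (rule sum.cong[OF refl]) (rule sum.swap)
    also have "\<dots> = (\<Sum>m<n. \<Sum>k<n. \<Sum>l<n. (c j k l * c i k m) *\<^sub>R (e m * e l))"
      by (rule sum.swap)
    also have "\<dots> = (\<Sum>m<n. \<Sum>l<n. \<Sum>k<n. (c j k l * c i k m) *\<^sub>R (e m * e l))"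
      by (rule sum.cong[OF refl]) (rule sum.swap)
    finally show ?thesis .
  qed
  also have "(\<Sum>k<n. \<Sum>l<n. \<Sum>m<n. (c j k l * c i l m) *\<^sub>R (e k * e m)) =
      (\<Sum>k<n. \<Sum>m<n. \<Sum>l<n. (c j k l * c i l m) *\<^sub>R (e k * e m))"
    by (rule sum.cong[OF refl]) (rule sum.swap)
  also have "(\<Sum>a<n. \<Sum>b<n. \<Sum>k<n. (c j k b * c i k a) *\<^sub>R (e a * e b)) +
      (\<Sum>a<n. \<Sum>b<n. \<Sum>k<n. (c j a k * c i k b) *\<^sub>R (e a * e b)) =
      (\<Sum>a<n. \<Sum>b<n. (\<Sum>k<n. c j k b * c i k a + c j a k * c i k b) *\<^sub>R (e a * e b))"
    by (simp add: scaleR_sum_left scaleR_add_left sum.distrib)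
  also have "\<dots> = (\<Sum>a<n. \<Sum>b<n. (\<Sum>k<n. c k i j * c k a b) *\<^sub>R (e a * e b))"
  proof -
    have "(\<Sum>k<n. c j k b * c i k a + c j a k * c i k b) = (\<Sum>k<n. c k i j * c k a b)"
      if "a < n" "b < n" for a b
    proof -
      \<comment> \<open>Up to sign, the two products are the last two terms of the cyclic sum in
        \<open>c_jacobi\<close>.\<close>
      have "c j k b * c i k a + c j a k * c i k b = c k i j * c k a b -
          (c k i j * c k a b + c k j a * c k i b + c k a i * c k j b)" for k
        using c_anti1[of j k b] c_anti1[of i k b] c_cyc[of i k a] c_cyc[of k j a] by simp
      then show ?thesis using c_jacobi[OF i j that] by (simp only: sum_subtractf)
    qed
    then show ?thesis by simp
  qed
  also have "(1/4) *\<^sub>R \<dots> = (\<Sum>a<n. \<Sum>b<n. \<Sum>k<n. (c k i j / 4 * c k a b) *\<^sub>R (e a * e b))"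
    by (simp add: scaleR_sum_left scaleR_sum_right)
  also have "\<dots> = (\<Sum>k<n. \<Sum>a<n. \<Sum>b<n. (c k i j / 4 * c k a b) *\<^sub>R (e a * e b))"
    by (rule sum_swap3[symmetric])
  also have "\<dots> = (\<Sum>k<n. c k i j *\<^sub>R P k)"
    by (simp add: P_def scaleR_sum_right)
  finally show ?thesis .
qed

text \<open>\<open>P i\<close> acts on both factors of \<open>H_eq\<close> by the adjoint
  representation, and antisymmetry of \<open>c\<close> makes the contraction invariant.\<close>

lemma P_H:
  assumes i: "i < n"
  shows "P i * H \<simeq> H * P i"
proof -
  have "P i * H - H * P i = (\<Sum>j<n. (P i * e j - e j * P i) * P j + e j * (P i * P j - P j * P i))"
    unfolding H_eq by (simp add: sum_distrib_left sum_distrib_right sum_subtractf algebra_simps)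
  also have "\<dots> \<simeq> (\<Sum>j<n. (\<Sum>l<n. c i j l *\<^sub>R e l) * P j + e j * (\<Sum>l<n. c l i j *\<^sub>R P l))"
    by (intro cong_sum cong_add cong_lmult cong_rmult P_e P_P) (use i in auto)
  also have "\<dots> = (\<Sum>j<n. \<Sum>l<n. c i j l *\<^sub>R (e l * P j)) + (\<Sum>j<n. \<Sum>l<n. c l i j *\<^sub>R (e j * P l))"
    by (simp add: sum_distrib_left sum_distrib_right sum.distrib)
  also have "(\<Sum>j<n. \<Sum>l<n. c l i j *\<^sub>R (e j * P l)) = (\<Sum>j<n. \<Sum>l<n. c j i l *\<^sub>R (e l * P j))"
    by (rule sum.swap)
  also have "(\<Sum>j<n. \<Sum>l<n. c i j l *\<^sub>R (e l * P j)) + \<dots> = 0"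
  proof -
    have "c j i l = - c i j l" for j l by (rule c_anti1)
    then show ?thesis by (simp only: scaleR_minus_left sum_negf right_minus)
  qed
  finally show ?thesis by (simp add: cong_def)
qed

text \<open>Expand the left factor of one copy of \<open>H * H\<close> and the right factor of
  another by \<open>H_eq\<close>. As \<open>P i\<close> commutes with \<open>H\<close>, the sum of
  the copies contains the anticommutators of \<open>e_H\<close>.\<close>

lemma H_H: "H * H \<simeq> - 3 *\<^sub>R (\<Sum>i<n. P i * P i)"
proof -
  have "2 *\<^sub>R (H * H) = (\<Sum>i<n. e i * P i) * H + H * (\<Sum>i<n. e i * P i)"
    by (simp add: scaleR_2 flip: H_eq)
  also have "\<dots> = (\<Sum>i<n. e i * (P i * H) + (H * e i) * P i)"
    by (simp add: sum_distrib_left sum_distrib_right sum.distrib mult.assoc)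
  also have "\<dots> \<simeq> (\<Sum>i<n. e i * (H * P i) + (H * e i) * P i)"
    by (intro cong_sum cong_add cong_lmult P_H cong_refl) auto
  also have "\<dots> = (\<Sum>i<n. (e i * H + H * e i) * P i)" by (simp add: algebra_simps)
  also have "\<dots> \<simeq> (\<Sum>i<n. (- 6 *\<^sub>R P i) * P i)"
    by (intro cong_sum cong_rmult e_H) auto
  finally have "(1/2) *\<^sub>R (2 *\<^sub>R (H * H)) \<simeq> (1/2) *\<^sub>R (\<Sum>i<n. (- 6 *\<^sub>R P i) * P i)"
    by (rule cong_scaleR)
  then show ?thesis by (simp add: scaleR_sum_right sum_negf)
qed

text \<open>The inner product of [X_j, X_k] with [X_l, X_m] in coordinates. It has the symmetries of
  a curvature tensor, the Jacobi identity taking the place of the Bianchi identity.\<close>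

definition K :: "nat \<Rightarrow> nat \<Rightarrow> nat \<Rightarrow> nat \<Rightarrow> real" where
  "K j k l m = (\<Sum>i<n. c i j k * c i l m)"

lemma K_anti: "K j k l m = - K k j l m"
  unfolding K_def sum_negf[symmetric]
proof (rule sum.cong[OF refl])
  show "c i j k * c i l m = - (c i k j * c i l m)" for i
    unfolding c_anti2[of i j k] by simp
qed

lemma K_self [simp]: "K j j l m = 0"
  using K_anti[of j j l m] by simp

lemma K_sym: "K j k l m = K l m j k"
  by (simp add: K_def mult.commute)

lemma K_cyc: "j < n \<Longrightarrow> k < n \<Longrightarrow> l < n \<Longrightarrow> m < n \<Longrightarrow> K j k l m + K k l j m + K l j k m = 0"
  using c_jacobi[of j k l m] by (simp add: K_def sum.distrib)

text \<open>The coefficients are symmetric in \<open>l\<close> and \<open>m\<close>, so only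
  anticommutators enter and the sum reduces to minus the trace of the coefficients.\<close>

lemma sum_K_ee: "(\<Sum>l<n. \<Sum>m<n. \<Sum>k<n. K k l k m *\<^sub>R (e l * e m)) \<simeq> (- B) *\<^sub>R 1"
proof -
  define b where "b l m = (\<Sum>k<n. K k l k m)" for l m
  have sym: "b l m = b m l" for l m
    unfolding b_def by (rule sum.cong[OF refl]) (rule K_sym)
  define S where "S = (\<Sum>l<n. \<Sum>m<n. b l m *\<^sub>R (e l * e m))"
  have "S = (\<Sum>l<n. \<Sum>m<n. b l m *\<^sub>R (e m * e l))"
    unfolding S_def by (subst sum.swap) (simp only: sym)
  then have "2 *\<^sub>R S = (\<Sum>l<n. \<Sum>m<n. b l m *\<^sub>R (e l * e m)) + (\<Sum>l<n. \<Sum>m<n. b l m *\<^sub>R (e m * e l))"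
    by (simp add: scaleR_2 flip: S_def)
  also have "\<dots> = (\<Sum>l<n. \<Sum>m<n. b l m *\<^sub>R (e l * e m + e m * e l))"
    by (simp add: sum.distrib scaleR_add_right)
  also have "\<dots> \<simeq> (\<Sum>l<n. \<Sum>m<n. b l m *\<^sub>R (- (d l m *\<^sub>R 1)))"
    by (intro cong_sum cong_scaleR) (simp add: cong_def ee)
  also have "\<dots> = (\<Sum>l<n. - (\<Sum>m<n. d l m *\<^sub>R (b l m *\<^sub>R 1)))"
    by (simp add: mult.commute sum_negf)
  also have "\<dots> = (\<Sum>l<n. - (2 *\<^sub>R (b l l *\<^sub>R 1)))"
    by (rule sum.cong[OF refl]) (simp only: sum_d lessThan_iff)
  also have "\<dots> = 2 *\<^sub>R ((- (\<Sum>l<n. b l l)) *\<^sub>R 1)"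
    by (simp add: scaleR_sum_left scaleR_sum_right sum_negf)
  also have "(\<Sum>l<n. b l l) = B"
  proof -
    have "(\<Sum>l<n. b l l) = (\<Sum>l<n. \<Sum>k<n. \<Sum>i<n. (c i k l)\<^sup>2)"
      by (simp add: b_def K_def power2_eq_square)
    also have "\<dots> = (\<Sum>l<n. \<Sum>k<n. \<Sum>i<n. (c l i k)\<^sup>2)"
    proof (intro sum.cong refl)
      show "(c i k l)\<^sup>2 = (c l i k)\<^sup>2" for i k l
        by (simp only: c_cyc[of l i k])
    qed
    also have "\<dots> = B" unfolding B_def by (rule sum.cong[OF refl]) (rule sum.swap)
    finally show ?thesis .
  qed
  finally have "(1/2) *\<^sub>R (2 *\<^sub>R S) \<simeq> (1/2) *\<^sub>R (2 *\<^sub>R ((- B) *\<^sub>R 1))" by (rule cong_scaleR)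
  then show ?thesis by (simp add: S_def b_def scaleR_sum_left)
qed

lemma sum_K_rotate:
  "(\<Sum>j<n. \<Sum>k<n. \<Sum>l<n. \<Sum>m<n. f k l j m) = (\<Sum>j<n. \<Sum>k<n. \<Sum>l<n. \<Sum>m<n. (f j k l m :: 'a::comm_monoid_add))"
  by (rule sum_swap3)

text \<open>The cyclic sum of \<open>K\<close> vanishes, so adding the three cyclic relabellings of the
  quartic sum leaves only the contractions produced by reordering.\<close>

lemma sum_P_P: "(\<Sum>i<n. P i * P i) \<simeq> (- B / 8) *\<^sub>R 1"
proof -
  define f where "f j k l m = e j * e k * e l * e m" for j k l m
  define Q where "Q = (\<Sum>j<n. \<Sum>k<n. \<Sum>l<n. \<Sum>m<n. K j k l m *\<^sub>R f j k l m)"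
  define b where "b = (\<Sum>l<n. \<Sum>m<n. \<Sum>k<n. K k l k m *\<^sub>R (e l * e m))"
  have b_eq: "b = (\<Sum>j<n. \<Sum>l<n. \<Sum>m<n. K j l j m *\<^sub>R (e l * e m))"
    unfolding b_def by (subst sum.swap[of _ "{..<n}" "{..<n}", symmetric], rule sum.cong[OF refl]) (rule sum.swap)
  have Q2: "Q = (\<Sum>j<n. \<Sum>k<n. \<Sum>l<n. \<Sum>m<n. K k l j m *\<^sub>R f k l j m)"
    unfolding Q_def by (rule sum_K_rotate[symmetric])
  have Q3: "Q = (\<Sum>j<n. \<Sum>k<n. \<Sum>l<n. \<Sum>m<n. K l j k m *\<^sub>R f l j k m)"
    unfolding Q2 by (rule sum_K_rotate[symmetric])
  \<comment> \<open>Both cyclic arrangements are brought to the order \<open>j k l m\<close>: here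
    \<open>e j\<close> moves to the front, in \<open>f3\<close> the leading \<open>e l\<close> moves
    to third place.\<close>
  have f2: "f k l j m \<simeq> f j k l m + (d k j *\<^sub>R (e l * e m) - d l j *\<^sub>R (e k * e m))"
    if "j < n" "k < n" "l < n" for j k l m
    using cong_rmult[OF ee_e[OF that], of "e m"] by (simp add: cong_def f_def algebra_simps)
  have f3: "f l j k m \<simeq> f j k l m + (d k l *\<^sub>R (e j * e m) - d j l *\<^sub>R (e k * e m))"
    if "j < n" "k < n" "l < n" for j k l m
    using cong_minus[OF cong_rmult[OF ee_e[OF that(3,1,2)], of "e m"]]
    by (simp add: cong_def f_def algebra_simps)
  have "3 *\<^sub>R Q = Q + Q + Q" by (simp add: scaleR_left.add[of 2 1, simplified] scaleR_2)
  also have "\<dots> = (\<Sum>j<n. \<Sum>k<n. \<Sum>l<n. \<Sum>m<n.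
      K j k l m *\<^sub>R f j k l m + K k l j m *\<^sub>R f k l j m + K l j k m *\<^sub>R f l j k m)"
    by (subst (3) Q3, subst (2) Q2, subst Q_def) (simp only: sum.distrib)
  also have "\<dots> \<simeq> (\<Sum>j<n. \<Sum>k<n. \<Sum>l<n. \<Sum>m<n. K j k l m *\<^sub>R f j k l m
      + K k l j m *\<^sub>R (f j k l m + (d k j *\<^sub>R (e l * e m) - d l j *\<^sub>R (e k * e m)))
      + K l j k m *\<^sub>R (f j k l m + (d k l *\<^sub>R (e j * e m) - d j l *\<^sub>R (e k * e m))))"
    by (intro cong_sum cong_add cong_scaleR f2 f3 cong_refl) auto
  \<comment> \<open>\<open>K_cyc\<close> cancels the quartic words. Of the four remaining
    contractions three equal \<open>2 *\<^sub>R b\<close>, and the last carries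
    \<open>K j j k m = 0\<close>.\<close>
  also have "\<dots> = (\<Sum>j<n. \<Sum>k<n. \<Sum>l<n. \<Sum>m<n.
      d k j *\<^sub>R (K k l j m *\<^sub>R (e l * e m)) + d l j *\<^sub>R (K l k j m *\<^sub>R (e k * e m))
      + d k l *\<^sub>R (K l j k m *\<^sub>R (e j * e m)) - d j l *\<^sub>R (K l j k m *\<^sub>R (e k * e m)))"
  proof (intro sum.cong refl)
    fix j k l m assume "j \<in> {..<n}" "k \<in> {..<n}" "l \<in> {..<n}" "m \<in> {..<n}"
    then have K: "K j k l m = - K k l j m - K l j k m" using K_cyc[of j k l m] by simp
    show "K j k l m *\<^sub>R f j k l m
      + K k l j m *\<^sub>R (f j k l m + (d k j *\<^sub>R (e l * e m) - d l j *\<^sub>R (e k * e m)))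
      + K l j k m *\<^sub>R (f j k l m + (d k l *\<^sub>R (e j * e m) - d j l *\<^sub>R (e k * e m))) =
      d k j *\<^sub>R (K k l j m *\<^sub>R (e l * e m)) + d l j *\<^sub>R (K l k j m *\<^sub>R (e k * e m))
      + d k l *\<^sub>R (K l j k m *\<^sub>R (e j * e m)) - d j l *\<^sub>R (K l j k m *\<^sub>R (e k * e m))"
      unfolding K K_anti[of l k] by (simp add: algebra_simps)
  qed
  also have "\<dots> = (\<Sum>j<n. \<Sum>k<n. \<Sum>l<n. \<Sum>m<n. d k j *\<^sub>R (K k l j m *\<^sub>R (e l * e m)))
      + (\<Sum>j<n. \<Sum>k<n. \<Sum>l<n. \<Sum>m<n. d l j *\<^sub>R (K l k j m *\<^sub>R (e k * e m)))
      + (\<Sum>j<n. \<Sum>k<n. \<Sum>l<n. \<Sum>m<n. d k l *\<^sub>R (K l j k m *\<^sub>R (e j * e m)))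
      - (\<Sum>j<n. \<Sum>k<n. \<Sum>l<n. \<Sum>m<n. d j l *\<^sub>R (K l j k m *\<^sub>R (e k * e m)))"
    by (simp only: sum.distrib sum_subtractf)
  also have "(\<Sum>j<n. \<Sum>k<n. \<Sum>l<n. \<Sum>m<n. d k j *\<^sub>R (K k l j m *\<^sub>R (e l * e m))) = 2 *\<^sub>R b"
  proof -
    have "(\<Sum>j<n. \<Sum>k<n. \<Sum>l<n. \<Sum>m<n. d k j *\<^sub>R (K k l j m *\<^sub>R (e l * e m))) =
        (\<Sum>j<n. 2 *\<^sub>R (\<Sum>l<n. \<Sum>m<n. K j l j m *\<^sub>R (e l * e m)))"
      by (rule sum.cong[OF refl]) (simp only: sum_d lessThan_iff scaleR_sum_right[symmetric])
    then show ?thesis by (simp only: b_eq scaleR_sum_right)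
  qed
  also have "(\<Sum>j<n. \<Sum>k<n. \<Sum>l<n. \<Sum>m<n. d l j *\<^sub>R (K l k j m *\<^sub>R (e k * e m))) = 2 *\<^sub>R b"
  proof -
    have "(\<Sum>j<n. \<Sum>k<n. \<Sum>l<n. \<Sum>m<n. d l j *\<^sub>R (K l k j m *\<^sub>R (e k * e m))) =
        (\<Sum>j<n. \<Sum>k<n. 2 *\<^sub>R (\<Sum>m<n. K j k j m *\<^sub>R (e k * e m)))"
      by (rule sum.cong[OF refl])+ (simp only: sum_d lessThan_iff scaleR_sum_right[symmetric])
    then show ?thesis by (simp only: b_eq scaleR_sum_right)
  qed
  also have "(\<Sum>j<n. \<Sum>k<n. \<Sum>l<n. \<Sum>m<n. d k l *\<^sub>R (K l j k m *\<^sub>R (e j * e m))) = 2 *\<^sub>R b"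
  proof -
    have "(\<Sum>j<n. \<Sum>k<n. \<Sum>l<n. \<Sum>m<n. d k l *\<^sub>R (K l j k m *\<^sub>R (e j * e m))) =
        (\<Sum>j<n. \<Sum>k<n. 2 *\<^sub>R (\<Sum>m<n. K k j k m *\<^sub>R (e j * e m)))"
      by (rule sum.cong[OF refl])+ (simp only: sum_d lessThan_iff scaleR_sum_right[symmetric])
    also have "\<dots> = (\<Sum>k<n. \<Sum>j<n. 2 *\<^sub>R (\<Sum>m<n. K k j k m *\<^sub>R (e j * e m)))"
      by (rule sum.swap)
    finally show ?thesis by (simp only: b_eq scaleR_sum_right)
  qed
  also have "(\<Sum>j<n. \<Sum>k<n. \<Sum>l<n. \<Sum>m<n. d j l *\<^sub>R (K l j k m *\<^sub>R (e k * e m))) = 0"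
    by (intro sum.neutral ballI) (simp add: d_def)
  \<comment> \<open>The factor 1/48 divides 3 Q by 3 and includes the 1/16 from the two factors 1/4
    in \<open>P i * P i\<close>.\<close>
  finally have "(1/48) *\<^sub>R (3 *\<^sub>R Q) \<simeq> (1/48) *\<^sub>R (2 *\<^sub>R b + 2 *\<^sub>R b + 2 *\<^sub>R b - 0)"
    by (rule cong_scaleR)
  then have "(1/16) *\<^sub>R Q \<simeq> (1/8) *\<^sub>R b" by (simp flip: scaleR_add_left)
  also have "\<dots> \<simeq> (1/8) *\<^sub>R ((- B) *\<^sub>R 1)"
    unfolding b_def by (intro cong_scaleR sum_K_ee)
  finally have "(1/16) *\<^sub>R Q \<simeq> (- B / 8) *\<^sub>R 1" by simp
  moreover have "(\<Sum>i<n. P i * P i) = (1/16) *\<^sub>R Q"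
  proof -
    have "P i * P i = (1/16) *\<^sub>R
        (\<Sum>j<n. \<Sum>k<n. \<Sum>l<n. \<Sum>m<n. (c i j k * c i l m) *\<^sub>R f j k l m)" for i
    proof -
      have "(\<Sum>j<n. \<Sum>k<n. c i j k *\<^sub>R (e j * e k)) * (\<Sum>l<n. \<Sum>m<n. c i l m *\<^sub>R (e l * e m)) =
          (\<Sum>j<n. \<Sum>k<n. c i j k *\<^sub>R (e j * e k) * (\<Sum>l<n. \<Sum>m<n. c i l m *\<^sub>R (e l * e m)))"
        by (simp only: sum_distrib_right)
      also have "\<dots> = (\<Sum>j<n. \<Sum>k<n. \<Sum>l<n. \<Sum>m<n. (c i j k * c i l m) *\<^sub>R f j k l m)"
        by (simp add: sum_distrib_left f_def mult.assoc mult.commute)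
      finally show ?thesis by (simp add: P_def)
    qed
    then have "(\<Sum>i<n. P i * P i) = (1/16) *\<^sub>R
        (\<Sum>i<n. \<Sum>j<n. \<Sum>k<n. \<Sum>l<n. \<Sum>m<n. (c i j k * c i l m) *\<^sub>R f j k l m)"
      by (simp add: scaleR_sum_right)
    also have "(\<Sum>i<n. \<Sum>j<n. \<Sum>k<n. \<Sum>l<n. \<Sum>m<n. (c i j k * c i l m) *\<^sub>R f j k l m) = Q"
      unfolding Q_def K_def scaleR_sum_left
      by (subst sum_swap3, rule sum.cong[OF refl], rule sum.cong[OF refl]) (rule sum_swap3)
    finally show ?thesis .
  qed
  ultimately show ?thesis by simp
qed

lemma H_square: "H * H \<simeq> (3 / 8 * B) *\<^sub>R 1"
proof -
  note H_H
  also have "- 3 *\<^sub>R (\<Sum>i<n. P i * P i) \<simeq> - 3 *\<^sub>R ((- B / 8) *\<^sub>R 1)"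
    by (intro cong_scaleR sum_P_P)
  finally show ?thesis by simp
qed

section \<open>Mixed terms and the square of the Dirac operator\<close>

lemma u_monomial2: assumes "i < n" "k < n" "l < n" shows "u i * (e k * e l) \<simeq> e k * e l * u i"
proof -
  have "u i * (e k * e l) = u i * e k * e l" by (simp add: mult.assoc)
  also have "\<dots> \<simeq> e k * u i * e l" using assms by (intro cong_rmult cong_sym[OF eu])
  also have "\<dots> = e k * (u i * e l)" by (simp add: mult.assoc)
  also have "\<dots> \<simeq> e k * (e l * u i)" using assms by (intro cong_lmult cong_sym[OF eu])
  finally show ?thesis by (simp add: mult.assoc)
qed

lemma u_P: assumes "i < n" "j < n" shows "u i * P j \<simeq> P j * u i"
proof -
  have "u i * P j = (1/4) *\<^sub>R (\<Sum>k<n. \<Sum>l<n. c j k l *\<^sub>R (u i * (e k * e l)))"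
    by (simp add: P_def sum_distrib_left)
  also have "\<dots> \<simeq> (1/4) *\<^sub>R (\<Sum>k<n. \<Sum>l<n. c j k l *\<^sub>R (e k * e l * u i))"
    by (intro cong_scaleR cong_sum u_monomial2) (use assms in auto)
  also have "\<dots> = P j * u i" by (simp add: P_def sum_distrib_right)
  finally show ?thesis .
qed

lemma u_H: assumes i: "i < n" shows "u i * H \<simeq> H * u i"
proof -
  have "u i * H = (\<Sum>j<n. u i * e j * P j)" by (simp add: H_eq sum_distrib_left mult.assoc)
  also have "\<dots> \<simeq> (\<Sum>j<n. e j * u i * P j)"
    by (intro cong_sum cong_rmult cong_sym[OF eu]) (use i in auto)
  also have "\<dots> = (\<Sum>j<n. e j * (u i * P j))" by (simp add: mult.assoc)
  also have "\<dots> \<simeq> (\<Sum>j<n. e j * (P j * u i))"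
    by (intro cong_sum cong_lmult u_P) (use i in auto)
  also have "\<dots> = H * u i" by (simp add: H_eq sum_distrib_right mult.assoc)
  finally show ?thesis .
qed

definition D0 :: 'r where "D0 = (\<Sum>i<n. e i * u i)"

text \<open>Adding the double sum to its relabelled copy and reordering the Clifford factors leaves
  the commutators of the \<open>u i\<close>, which assemble into the \<open>P k\<close>, and the
  diagonal terms. Both are then halved.\<close>

lemma D0_square: "D0 * D0 \<simeq> 2 *\<^sub>R (\<Sum>i<n. P i * u i) - (\<Sum>i<n. u i * u i)"
proof -
  have "D0 * D0 = (\<Sum>i<n. \<Sum>j<n. e i * (u i * e j) * u j)"
    by (simp add: D0_def sum_distrib_left sum_distrib_right mult.assoc) (rule sum.swap)
  also have "\<dots> \<simeq> (\<Sum>i<n. \<Sum>j<n. e i * (e j * u i) * u j)"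
    by (intro cong_sum cong_rmult cong_lmult cong_sym[OF eu]) auto
  finally have 1: "D0 * D0 \<simeq> (\<Sum>i<n. \<Sum>j<n. e i * e j * (u i * u j))" by (simp add: mult.assoc)
  also have "\<dots> = (\<Sum>i<n. \<Sum>j<n. e j * e i * (u j * u i))" by (rule sum.swap)
  also have "\<dots> \<simeq> (\<Sum>i<n. \<Sum>j<n. (- (e i * e j) - d i j *\<^sub>R 1) * (u j * u i))"
    by (intro cong_sum cong_rmult) (use ee in \<open>auto simp: cong_def algebra_simps\<close>)
  also have "\<dots> = (\<Sum>i<n. \<Sum>j<n. - (e i * e j * (u j * u i)) - d i j *\<^sub>R (u j * u i))"
    by (simp add: algebra_simps)
  finally have "2 *\<^sub>R (D0 * D0) \<simeq> (\<Sum>i<n. \<Sum>j<n. e i * e j * (u i * u j)) +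
      (\<Sum>i<n. \<Sum>j<n. - (e i * e j * (u j * u i)) - d i j *\<^sub>R (u j * u i))"
    using cong_add[OF 1] by (simp add: scaleR_2)
  also have "\<dots> = (\<Sum>i<n. \<Sum>j<n. e i * e j * (u i * u j - u j * u i)) -
      (\<Sum>i<n. \<Sum>j<n. d i j *\<^sub>R (u j * u i))"
    by (simp add: sum_subtractf sum_negf right_diff_distrib)
  also have "(\<Sum>i<n. \<Sum>j<n. d i j *\<^sub>R (u j * u i)) = 2 *\<^sub>R (\<Sum>i<n. u i * u i)"
    by (simp add: sum_d scaleR_sum_right)
  also have "(\<Sum>i<n. \<Sum>j<n. e i * e j * (u i * u j - u j * u i)) - 2 *\<^sub>R (\<Sum>i<n. u i * u i) \<simeq>
      (\<Sum>i<n. \<Sum>j<n. e i * e j * (\<Sum>k<n. c k i j *\<^sub>R u k)) - 2 *\<^sub>R (\<Sum>i<n. u i * u i)"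
    by (intro cong_diff cong_sum cong_lmult uu cong_refl) auto
  also have "(\<Sum>i<n. \<Sum>j<n. e i * e j * (\<Sum>k<n. c k i j *\<^sub>R u k)) =
      (\<Sum>i<n. \<Sum>j<n. \<Sum>k<n. c k i j *\<^sub>R (e i * e j * u k))"
    by (simp add: sum_distrib_left)
  also have "\<dots> = (\<Sum>k<n. \<Sum>i<n. \<Sum>j<n. c k i j *\<^sub>R (e i * e j * u k))"
    by (rule sum_swap3[symmetric])
  also have "\<dots> = (\<Sum>k<n. 4 *\<^sub>R (P k * u k))"
    by (simp add: P_def sum_distrib_right)
  finally have "(1/2) *\<^sub>R (2 *\<^sub>R (D0 * D0)) \<simeq>
      (1/2) *\<^sub>R ((\<Sum>k<n. 4 *\<^sub>R (P k * u k)) - 2 *\<^sub>R (\<Sum>i<n. u i * u i))"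
    by (rule cong_scaleR)
  then show ?thesis by (simp add: scaleR_diff_right scaleR_sum_right)
qed

lemma D0_H: "D0 * H + H * D0 \<simeq> - 6 *\<^sub>R (\<Sum>i<n. P i * u i)"
proof -
  have "D0 * H + H * D0 = (\<Sum>i<n. e i * (u i * H) + H * e i * u i)"
    by (simp add: D0_def sum_distrib_left sum_distrib_right sum.distrib mult.assoc)
  also have "\<dots> \<simeq> (\<Sum>i<n. e i * (H * u i) + H * e i * u i)"
    by (intro cong_sum cong_add cong_lmult u_H cong_refl) auto
  also have "\<dots> = (\<Sum>i<n. (e i * H + H * e i) * u i)" by (simp add: algebra_simps)
  also have "\<dots> \<simeq> (\<Sum>i<n. (- 6 *\<^sub>R P i) * u i)"
    by (intro cong_sum cong_rmult e_H) auto
  also have "\<dots> = - 6 *\<^sub>R (\<Sum>i<n. P i * u i)" by (simp add: scaleR_sum_right sum_negf)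
  finally show ?thesis .
qed

text \<open>The mixed sum receives 2 from \<open>D0_square\<close> and -6t from \<open>D0_H\<close>,
  hence 2 - 6t = -2 (3t - 1) in total; the square of \<open>H\<close> is a scalar.\<close>

theorem Dirac_square:
  "(D0 + t *\<^sub>R H) * (D0 + t *\<^sub>R H) \<simeq> - (\<Sum>i<n. u i * u i)
    + (3 * t - 1) *\<^sub>R (- (\<Sum>i<n. P i * u i + u i * P i)) + (3 / 8 * t\<^sup>2 * B) *\<^sub>R 1"
proof -
  define W where "W = (\<Sum>i<n. P i * u i)"
  define C where "C = (\<Sum>i<n. u i * u i)"
  have "(D0 + t *\<^sub>R H) * (D0 + t *\<^sub>R H) = D0 * D0 + t *\<^sub>R (D0 * H + H * D0) + t\<^sup>2 *\<^sub>R (H * H)"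
    by (simp add: algebra_simps power2_eq_square)
  also have "\<dots> \<simeq> (2 *\<^sub>R W - C) + t *\<^sub>R (- 6 *\<^sub>R W) + t\<^sup>2 *\<^sub>R ((3 / 8 * B) *\<^sub>R 1)"
    unfolding W_def C_def by (intro cong_add cong_scaleR D0_square D0_H H_square)
  also have "\<dots> = - C + (3 * t - 1) *\<^sub>R (- (2 *\<^sub>R W)) + (3 / 8 * t\<^sup>2 * B) *\<^sub>R 1"
    by (simp add: algebra_simps)
  \<comment> \<open>The mixed sum is symmetrised because the coproduct yields these products in both
    orders, see \<open>T_elem_eq\<close>.\<close>
  also have "\<dots> \<simeq> - C + (3 * t - 1) *\<^sub>R (- (\<Sum>i<n. P i * u i + u i * P i)) + (3 / 8 * t\<^sup>2 * B) *\<^sub>R 1"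
  proof (intro cong_add cong_scaleR cong_minus cong_refl)
    have "2 *\<^sub>R W = (\<Sum>i<n. P i * u i + P i * u i)" by (simp add: W_def scaleR_2 sum.distrib)
    also have "\<dots> \<simeq> (\<Sum>i<n. P i * u i + u i * P i)"
      by (intro cong_sum cong_add cong_sym[OF u_P] cong_refl) auto
    finally show "2 *\<^sub>R W \<simeq> (\<Sum>i<n. P i * u i + u i * P i)" .
  qed
  finally show ?thesis unfolding C_def .
qed

end

subsection \<open>The free algebra\<close>

lemma fa_mult_Nil: "fa_mult p q [] = p [] * q []"
  by (simp add: fa_mult_def)

text \<open>Splitting off the empty prefix turns the convolution into a recursion on the word, so
  that identities follow by induction.\<close>

lemma fa_mult_Cons: "fa_mult p q (a # w) = p [] * q (a # w) + fa_mult (\<lambda>v. p (a # v)) q w"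
  unfolding fa_mult_def length_Cons by (subst sum.atMost_Suc_shift) simp

lemma fa_mult_add_left: "fa_mult (\<lambda>v. p v + q v) r w = fa_mult p r w + fa_mult q r w"
  by (simp add: fa_mult_def algebra_simps sum.distrib)

lemma fa_mult_add_right: "fa_mult p (\<lambda>v. q v + r v) w = fa_mult p q w + fa_mult p r w"
  by (simp add: fa_mult_def algebra_simps sum.distrib)

lemma fa_mult_smult_left: "fa_mult (\<lambda>v. c * p v) r w = c * fa_mult p r w"
  by (simp add: fa_mult_def sum_distrib_left mult.assoc)

lemma fa_mult_smult_right: "fa_mult p (\<lambda>v. c * r v) w = c * fa_mult p r w"
  by (simp add: fa_mult_def sum_distrib_left mult.left_commute)

lemma fa_mult_assoc: "fa_mult (fa_mult p q) r = fa_mult p (fa_mult q r)"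
proof
  show "fa_mult (fa_mult p q) r w = fa_mult p (fa_mult q r) w" for w
    \<comment> \<open>\<open>p\<close> must vary, as the recursion replaces it by its shift
      \<open>\<lambda>v. p (a # v)\<close>.\<close>
    by (induction w arbitrary: p)
      (simp_all add: fa_mult_Nil fa_mult_Cons fa_mult_add_left fa_mult_smult_left algebra_simps)
qed

lemma fa_mult_one_left: "fa_mult fa_one p = p"
proof
  show "fa_mult fa_one p w = p w" for w
    by (cases w) (simp_all add: fa_mult_Nil fa_mult_Cons fa_one_def, simp add: fa_mult_def)
qed

lemma fa_mult_one_right: "fa_mult p fa_one = p"
proof
  show "fa_mult p fa_one w = p w" for w
    by (induction w arbitrary: p) (simp_all add: fa_mult_Nil fa_mult_Cons, simp_all add: fa_one_def)
qed

abbreviation fa_fin :: "'a fa \<Rightarrow> bool" where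
  "fa_fin p \<equiv> finite {w. p w \<noteq> 0}"

text \<open>A nonzero coefficient needs a split of the word into words from the two
  supports.\<close>

lemma fa_fin_mult: assumes "fa_fin p" "fa_fin q" shows "fa_fin (fa_mult p q)"
proof (rule finite_subset)
  show "{w. fa_mult p q w \<noteq> 0} \<subseteq> (\<lambda>(v, w). v @ w) ` ({w. p w \<noteq> 0} \<times> {w. q w \<noteq> 0})"
  proof
    fix w assume "w \<in> {w. fa_mult p q w \<noteq> 0}"
    then obtain i where "p (take i w) * q (drop i w) \<noteq> 0"
      unfolding fa_mult_def mem_Collect_eq by (meson sum.not_neutral_contains_not_neutral)
    then have "(take i w, drop i w) \<in> {w. p w \<noteq> 0} \<times> {w. q w \<noteq> 0}" by simp
    then show "w \<in> (\<lambda>(v, w). v @ w) ` ({w. p w \<noteq> 0} \<times> {w. q w \<noteq> 0})"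
      by (rule rev_image_eqI) simp
  qed
  show "finite ((\<lambda>(v, w). v @ w) ` ({w. p w \<noteq> 0} \<times> {w. q w \<noteq> 0}))" using assms by simp
qed

lemma fa_fin_add: "fa_fin p \<Longrightarrow> fa_fin q \<Longrightarrow> fa_fin (\<lambda>w. p w + q w)"
  by (rule finite_subset[of _ "{w. p w \<noteq> 0} \<union> {w. q w \<noteq> 0}"]) auto

text \<open>The ideal is closed by definition only under multiplication by letters, hence by
  elements of finite support; on \<open>free_alg\<close> it becomes a two-sided ideal of a ring.\<close>

typedef 'a free_alg = "{p :: 'a fa. fa_fin p}" morphisms coeffs Free_alg
  by (rule exI[of _ "\<lambda>_. 0"]) simp

lemma fa_fin_coeffs [simp]: "fa_fin (coeffs x)"
  using coeffs[of x] by simp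

lemma coeffs_Free_alg [simp]: "fa_fin p \<Longrightarrow> coeffs (Free_alg p) = p"
  by (simp add: Free_alg_inverse)

instantiation free_alg :: (type) real_algebra_1
begin

definition "0 = Free_alg fa_zero"
definition "1 = Free_alg fa_one"
definition "x + y = Free_alg (fa_add (coeffs x) (coeffs y))"
definition "x - y = Free_alg (fa_diff (coeffs x) (coeffs y))"
definition "- x = Free_alg (fa_smult (-1) (coeffs x))"
definition "x * y = Free_alg (fa_mult (coeffs x) (coeffs y))"
definition "r *\<^sub>R x = Free_alg (fa_smult (complex_of_real r) (coeffs x))"

lemma coeffs_zero: "coeffs 0 = fa_zero"
  by (simp add: zero_free_alg_def fa_zero_def)

lemma coeffs_one: "coeffs 1 = fa_one"
  by (simp add: one_free_alg_def fa_one_def)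

lemma coeffs_add: "coeffs (x + y) = fa_add (coeffs x) (coeffs y)"
  unfolding plus_free_alg_def fa_add_def by (simp add: fa_fin_add)

lemma fa_fin_smult: "fa_fin p \<Longrightarrow> fa_fin (fa_smult c p)"
  unfolding fa_smult_def by (rule finite_subset[of _ "{w. p w \<noteq> 0}"]) auto

lemma coeffs_uminus: "coeffs (- x) = fa_smult (-1) (coeffs x)"
  unfolding uminus_free_alg_def by (simp add: fa_fin_smult)

lemma coeffs_diff: "coeffs (x - y) = fa_diff (coeffs x) (coeffs y)"
proof -
  have "fa_fin (fa_diff (coeffs x) (coeffs y))"
    using fa_fin_add[of "coeffs x" "fa_smult (-1) (coeffs y)"] fa_fin_smult[of "coeffs y" "-1"]
    by (simp add: fa_smult_def fa_diff_def)
  then show ?thesis by (simp add: minus_free_alg_def)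
qed

lemma coeffs_mult: "coeffs (x * y) = fa_mult (coeffs x) (coeffs y)"
  unfolding times_free_alg_def by (simp add: fa_fin_mult)

lemma coeffs_scaleR: "coeffs (r *\<^sub>R x) = fa_smult (complex_of_real r) (coeffs x)"
  unfolding scaleR_free_alg_def by (simp add: fa_fin_smult)

lemmas coeffs_simps = coeffs_zero coeffs_one coeffs_add coeffs_uminus coeffs_diff coeffs_mult
  coeffs_scaleR

instance
proof
  fix x y z :: "'a free_alg" and r s :: real
  note [simp] = coeffs_simps fa_add_def fa_diff_def fa_smult_def fa_zero_def coeffs_inject[symmetric]
  show "x + y + z = x + (y + z)" "x + y = y + x" "0 + x = x" "- x + x = 0" "x - y = x + - y"
    "r *\<^sub>R (x + y) = r *\<^sub>R x + r *\<^sub>R y" "(r + s) *\<^sub>R x = r *\<^sub>R x + s *\<^sub>R x"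
    "r *\<^sub>R s *\<^sub>R x = (r * s) *\<^sub>R x" "1 *\<^sub>R x = x"
    by (simp_all add: algebra_simps)
  show "x * y * z = x * (y * z)" "1 * x = x" "x * 1 = x"
    by (simp_all add: fa_mult_assoc fa_mult_one_left fa_mult_one_right)
  show "(x + y) * z = x * z + y * z" "x * (y + z) = x * y + x * z"
    "r *\<^sub>R x * y = r *\<^sub>R (x * y)" "x * r *\<^sub>R y = r *\<^sub>R (x * y)"
    by (simp_all add: fun_eq_iff fa_mult_add_left fa_mult_add_right fa_mult_smult_left
      fa_mult_smult_right)
  show "(0::'a free_alg) \<noteq> 1"
    by (auto simp: fa_one_def fun_eq_iff intro!: exI[of _ "[]"])
qed

end

lemma coeffs_sum: "coeffs (sum f A) = fa_sum (\<lambda>i. coeffs (f i)) A"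
  by (induction A rule: infinite_finite_induct)
    (simp_all add: coeffs_zero coeffs_add fa_sum_def fa_zero_def fa_add_def)

lemma fa_fin_gen: "fa_fin (fa_gen a)"
  by (simp add: fa_gen_def)

definition fgen :: "'a \<Rightarrow> 'a free_alg" where
  "fgen a = Free_alg (fa_gen a)"

lemma coeffs_fgen [simp]: "coeffs (fgen a) = fa_gen a"
  by (simp add: fgen_def fa_fin_gen)

section \<open>Words, finite support and ideals\<close>

definition fa_word :: "'a list \<Rightarrow> 'a fa" where
  "fa_word v = (\<lambda>w. if w = v then 1 else 0)"

lemma fa_word_Cons: "fa_word (a # v) = fa_mult (fa_gen a) (fa_word v)"
proof
  fix w
  show "fa_word (a # v) w = fa_mult (fa_gen a) (fa_word v) w"
  proof (cases w)
    case (Cons b w')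
    have "(\<lambda>x. fa_gen a (b # x)) = (\<lambda>x. (if a = b then 1 else 0) * fa_one x)"
      by (auto simp: fa_gen_def fa_one_def)
    then show ?thesis
      using Cons by (simp add: fa_mult_Cons fa_mult_smult_left fa_mult_one_left)
        (auto simp: fa_gen_def fa_word_def)
  qed (simp add: fa_mult_Nil fa_gen_def fa_word_def)
qed

lemma fa_word_snoc: "fa_word (v @ [a]) = fa_mult (fa_word v) (fa_gen a)"
proof (induction v)
  case Nil
  have "fa_word [] = (fa_one :: 'a fa)" "fa_word [a] = fa_gen a"
    by (simp_all add: fa_word_def fa_one_def fa_gen_def)
  then show ?case by (simp add: fa_mult_one_left)
qed (simp add: fa_word_Cons fa_mult_assoc)

lemma fa_word_Nil: "fa_word [] = fa_one"
  by (simp add: fa_word_def fa_one_def)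

lemma fa_ideal_word_lmult: "q \<in> fa_ideal R \<Longrightarrow> fa_mult (fa_word v) q \<in> fa_ideal R"
  by (induction v) (simp_all add: fa_word_Nil fa_mult_one_left fa_word_Cons fa_mult_assoc fa_ideal.lmult)

lemma fa_ideal_word_rmult: "q \<in> fa_ideal R \<Longrightarrow> fa_mult q (fa_word v) \<in> fa_ideal R"
  by (induction v rule: rev_induct)
    (simp_all add: fa_word_Nil fa_mult_one_right fa_word_snoc fa_ideal.rmult flip: fa_mult_assoc)

text \<open>The support is emptied one word at a time; this carries statements from words to all
  elements of finite support.\<close>

lemma fa_fin_induct [consumes 1, case_names zero add]:
  assumes "fa_fin p" and "Q fa_zero"
    and step: "\<And>c v p. Q p \<Longrightarrow> Q (fa_add (fa_smult c (fa_word v)) p)"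
  shows "Q p"
proof -
  have "Q p" if "finite A" "{w. p w \<noteq> 0} \<subseteq> A" for A and p :: "'a fa"
    using that
  proof (induction A arbitrary: p)
    case empty
    then have "p = fa_zero" by (auto simp: fa_zero_def)
    then show ?case using assms by simp
  next
    case (insert v A)
    have "Q (\<lambda>w. if w = v then 0 else p w)" using insert by (intro insert.IH) auto
    then have "Q (fa_add (fa_smult (p v) (fa_word v)) (\<lambda>w. if w = v then 0 else p w))" by (rule step)
    also have "fa_add (fa_smult (p v) (fa_word v)) (\<lambda>w. if w = v then 0 else p w) = p"
      by (auto simp: fa_add_def fa_smult_def fa_word_def)
    finally show ?case .
  qed
  then show ?thesis using assms(1) by blast
qed

lemma fa_ideal_lmult:
  assumes "fa_fin p" "q \<in> fa_ideal R"
  shows "fa_mult p q \<in> fa_ideal R"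
  using assms
proof (induction p rule: fa_fin_induct)
  case zero
  have "fa_mult fa_zero q = fa_zero" by (simp add: fa_mult_def fa_zero_def)
  then show ?case by (simp add: fa_ideal.zero)
next
  case (add c v p)
  have "fa_mult (fa_add (fa_smult c (fa_word v)) p) q =
      fa_add (fa_smult c (fa_mult (fa_word v) q)) (fa_mult p q)"
    by (simp add: fun_eq_iff fa_add_def fa_smult_def fa_mult_add_left fa_mult_smult_left)
  then show ?case using add by (simp add: fa_ideal.intros fa_ideal_word_lmult)
qed

lemma fa_ideal_rmult:
  assumes "fa_fin p" "q \<in> fa_ideal R"
  shows "fa_mult q p \<in> fa_ideal R"
  using assms
proof (induction p rule: fa_fin_induct)
  case zero
  have "fa_mult q fa_zero = fa_zero" by (simp add: fa_mult_def fa_zero_def)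
  then show ?case by (simp add: fa_ideal.zero)
next
  case (add c v p)
  have "fa_mult q (fa_add (fa_smult c (fa_word v)) p) =
      fa_add (fa_smult c (fa_mult q (fa_word v))) (fa_mult q p)"
    by (simp add: fun_eq_iff fa_add_def fa_smult_def fa_mult_add_right fa_mult_smult_right)
  then show ?case using add by (simp add: fa_ideal.intros fa_ideal_word_rmult)
qed

section \<open>Homomorphisms determined by the letters\<close>

lemma fa_hom_superset:
  assumes "finite A" "{v. p v \<noteq> 0} \<subseteq> A"
  shows "fa_hom f p w = (\<Sum>v\<in>A. p v * fa_word_img f v w)"
  unfolding fa_hom_def using assms by (intro sum.mono_neutral_left) auto

lemma fa_hom_add:
  assumes "fa_fin p" "fa_fin q"
  shows "fa_hom f (fa_add p q) = fa_add (fa_hom f p) (fa_hom f q)"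
proof
  fix w
  \<comment> \<open>\<open>fa_hom\<close> sums over the support of its argument; a common finite
    superset lets the sums be added termwise.\<close>
  define A where "A = {v. p v \<noteq> 0} \<union> {v. q v \<noteq> 0}"
  have "finite A" using assms by (simp add: A_def)
  then have *: "fa_hom f r w = (\<Sum>v\<in>A. r v * fa_word_img f v w)" if "{v. r v \<noteq> 0} \<subseteq> A" for r
    using that by (rule fa_hom_superset)
  show "fa_hom f (fa_add p q) w = fa_add (fa_hom f p) (fa_hom f q) w"
    unfolding fa_add_def
    by (subst (1 2 3) *) (auto simp: A_def distrib_right sum.distrib)
qed

lemma fa_hom_smult:
  assumes "fa_fin p"
  shows "fa_hom f (fa_smult c p) = fa_smult c (fa_hom f p)"
proof
  fix w
  have "fa_hom f (fa_smult c p) w = (\<Sum>v\<in>{v. p v \<noteq> 0}. c * p v * fa_word_img f v w)"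
    using assms by (subst fa_hom_superset[of "{v. p v \<noteq> 0}"]) (auto simp: fa_smult_def)
  then show "fa_hom f (fa_smult c p) w = fa_smult c (fa_hom f p) w"
    by (simp add: fa_hom_def fa_smult_def sum_distrib_left mult.assoc)
qed

lemma fa_hom_word: "fa_hom f (fa_word v) = fa_word_img f v"
  by (simp add: fun_eq_iff fa_hom_superset[of "{v}"] fa_word_def)

text \<open>By \<open>T_elem_eq\<close>, \<open>T_elem\<close> is built from \<open>1\<close> and
  products of two letters, so these rules compute its image.\<close>

lemma fa_hom_coeffs:
  "fa_hom f (coeffs (x + y)) = fa_add (fa_hom f (coeffs x)) (fa_hom f (coeffs y))"
  "fa_hom f (coeffs (r *\<^sub>R x)) = fa_smult (complex_of_real r) (fa_hom f (coeffs x))"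
  "fa_hom f (coeffs (- x)) = fa_smult (-1) (fa_hom f (coeffs x))"
  "fa_hom f (coeffs (sum g A)) = fa_sum (\<lambda>i. fa_hom f (coeffs (g i))) A"
  "fa_hom f (coeffs 1) = fa_one"
  "fa_hom f (coeffs (fgen a * fgen b)) = fa_mult (f a) (f b)"
proof -
  show add: "fa_hom f (coeffs (x + y)) = fa_add (fa_hom f (coeffs x)) (fa_hom f (coeffs y))" for x y
    by (simp add: coeffs_simps fa_hom_add)
  show "fa_hom f (coeffs (r *\<^sub>R x)) = fa_smult (complex_of_real r) (fa_hom f (coeffs x))"
    "fa_hom f (coeffs (- x)) = fa_smult (-1) (fa_hom f (coeffs x))"
    by (simp_all add: coeffs_simps fa_hom_smult)
  show "fa_hom f (coeffs (sum g A)) = fa_sum (\<lambda>i. fa_hom f (coeffs (g i))) A"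
    by (induction A rule: infinite_finite_induct)
      (simp_all add: add, simp_all add: coeffs_zero fa_sum_def fa_add_def fa_hom_def fa_zero_def)
  show "fa_hom f (coeffs 1) = fa_one"
    using fa_hom_word[of f "[]"] by (simp add: coeffs_one fa_word_Nil fa_word_img_def)
  have "coeffs (fgen a * fgen b) = fa_word [a, b]"
    by (simp add: coeffs_simps fa_word_Cons fa_word_Nil fa_mult_one_right)
  then show "fa_hom f (coeffs (fgen a * fgen b)) = fa_mult (f a) (f b)"
    by (simp add: fa_hom_word fa_word_img_def fa_mult_one_right)
qed

section \<open>Structure constants in an orthonormal basis\<close>

lemma orthonormal_basis_parseval:
  fixes X :: "nat \<Rightarrow> 'g::euclidean_space"
  assumes "orthonormal_basis n X"
  shows "(\<Sum>i<n. inner (X i) x * inner (X i) y) = inner x y"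
proof -
  have n: "n = DIM('g)" and on: "\<And>i j. i < n \<Longrightarrow> j < n \<Longrightarrow> inner (X i) (X j) = (if i = j then 1 else 0)"
    using assms by (auto simp: orthonormal_basis_def)
  have inj: "inj_on X {..<n}"
    by (rule inj_onI) (metis on lessThan_iff zero_neq_one)
  have "pairwise orthogonal (X ` {..<n})" by (auto simp: pairwise_def orthogonal_def on)
  moreover have "0 \<notin> X ` {..<n}" using on by force
  ultimately have "independent (X ` {..<n})" by (rule pairwise_orthogonal_independent)
  then have span: "span (X ` {..<n}) = UNIV"
    using card_ge_dim_independent[of "X ` {..<n}" UNIV] inj n by (auto simp: card_image)
  \<comment> \<open>The remainder of the expansion is orthogonal to every \<open>X j\<close>, and
    these span because \<open>n\<close> is the dimension.\<close>
  define z where "z = x - (\<Sum>i<n. inner (X i) x *\<^sub>R X i)"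
  have "inner z (X j) = 0" if "j < n" for j
  proof -
    have "inner z (X j) = inner x (X j) - (\<Sum>i<n. if i = j then inner (X i) x else 0)"
      unfolding z_def inner_diff_left inner_sum_left using that
      by (intro arg_cong2[where f="(-)"] sum.cong refl) (auto simp: on)
    then show ?thesis using that by (simp add: inner_commute)
  qed
  then have "z = 0"
    using orthogonal_to_span[of z "X ` {..<n}" z] span by (auto simp: orthogonal_def)
  then have "x = (\<Sum>i<n. inner (X i) x *\<^sub>R X i)" by (simp add: z_def)
  then have "inner x y = inner (\<Sum>i<n. inner (X i) x *\<^sub>R X i) y" by simp
  then show ?thesis by (simp add: inner_sum_left)
qed

context compact_lie
begin

lemma sc_anti1: "sc br X i j k = - sc br X j i k"
  unfolding sc_def by (subst inner_br_cyc[symmetric], subst br_anti) (simp add: inner_br_cyc)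

lemma sc_anti2: "sc br X i j k = - sc br X i k j"
  unfolding sc_def by (subst br_anti) simp

context
  fixes n and X :: "nat \<Rightarrow> 'g"
  assumes X: "orthonormal_basis n X"
begin

lemma sum_sc: "(\<Sum>m<n. sc br X m i j * sc br X m k l) = inner (br (X i) (X j)) (br (X k) (X l))"
  unfolding sc_def by (rule orthonormal_basis_parseval[OF X])

text \<open>Parseval turns each contraction into an inner product of brackets; moving
  \<open>X l\<close> to the other slot leaves the Jacobi identity.\<close>

lemma sc_jacobi:
  "(\<Sum>m<n. sc br X m i j * sc br X m k l + sc br X m j k * sc br X m i l
     + sc br X m k i * sc br X m j l) = 0"
proof -
  have "br (br x y) z + br (br y z) x + br (br z x) y = 0" for x y z
    using jacobi[of x y z] br_anti[of "br y z" x] br_anti[of "br z x" y] br_anti[of x z]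
    by (simp add: br_simps)
  then have "inner (br (br x y) z + br (br y z) x + br (br z x) y) w = 0" for x y z w by simp
  then show ?thesis by (simp add: sum.distrib sum_sc inner_add_left inner_br_cyc)
qed

text \<open>The squared Hilbert-Schmidt norm of \<open>br x\<close>, computed in two orthonormal
  bases: skewness passes to the adjoint, and Parseval applies.\<close>

lemma sum_bracket_basis: "(\<Sum>k<n. (norm (br x (X k)))\<^sup>2) = (\<Sum>e\<in>Basis. (norm (br x e))\<^sup>2)"
proof -
  have "(\<Sum>k<n. (norm (br x (X k)))\<^sup>2) =
      (\<Sum>k<n. \<Sum>e\<in>Basis. inner (br x (X k)) e * inner (br x (X k)) e)"
    unfolding power2_norm_eq_inner by (rule sum.cong[OF refl]) (rule euclidean_inner)
  also have "\<dots> = (\<Sum>e\<in>Basis. \<Sum>k<n. inner (X k) (br x e) * inner (X k) (br x e))"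
    by (subst sum.swap) (simp add: inner_br)
  also have "\<dots> = (\<Sum>e\<in>Basis. (norm (br x e))\<^sup>2)"
    by (simp add: orthonormal_basis_parseval[OF X] power2_norm_eq_inner)
  finally show ?thesis .
qed

lemma sum_sc_square:
  "(\<Sum>i<n. \<Sum>j<n. \<Sum>k<n. (sc br X i j k)\<^sup>2) = (\<Sum>e\<in>Basis. \<Sum>f\<in>Basis. (norm (br e f))\<^sup>2)"
proof -
  have norm_anti: "norm (br x y) = norm (br y x)" for x y by (subst br_anti) simp
  have "(\<Sum>i<n. \<Sum>j<n. \<Sum>k<n. (sc br X i j k)\<^sup>2) = (\<Sum>j<n. \<Sum>k<n. \<Sum>i<n. (sc br X i j k)\<^sup>2)"
    by (rule sum_swap3)
  also have "\<dots> = (\<Sum>j<n. \<Sum>k<n. (norm (br (X j) (X k)))\<^sup>2)"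
    by (simp add: power2_eq_square[of "sc br X _ _ _"] sum_sc power2_norm_eq_inner)
  also have "\<dots> = (\<Sum>j<n. \<Sum>f\<in>Basis. (norm (br (X j) f))\<^sup>2)"
    by (simp only: sum_bracket_basis)
  also have "\<dots> = (\<Sum>f\<in>Basis. \<Sum>j<n. (norm (br f (X j)))\<^sup>2)"
    by (subst sum.swap) (simp only: norm_anti)
  also have "\<dots> = (\<Sum>e\<in>Basis. \<Sum>f\<in>Basis. (norm (br e f))\<^sup>2)"
    by (simp only: sum_bracket_basis)
  finally show ?thesis .
qed

end

end

section \<open>Transfer to the free algebra\<close>

lemma fa_sum_Times3:
  "fa_sum (\<lambda>(i, j, k). f i j k) (A \<times> B \<times> C) = fa_sum (\<lambda>i. fa_sum (\<lambda>j. fa_sum (f i j) C) B) A"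
  by (simp add: fa_sum_def sum.cartesian_product split_def)

lemma fa_sum_Times: "fa_sum (\<lambda>(i, j). f i j) (A \<times> B) = fa_sum (\<lambda>i. fa_sum (f i) B) A"
  by (simp add: fa_sum_def sum.cartesian_product split_def)

text \<open>The squares cancel in the coproduct term. The mixed products stay in both orders, since
  the two kinds of letters do not commute in the free algebra.\<close>

lemma T_elem_eq:
  "T_elem n t r = coeffs (- (\<Sum>i<n. fgen (Inr i) * fgen (Inr i))
    + (3 * t - 1) *\<^sub>R (- (\<Sum>i<n. fgen (Inl i) * fgen (Inr i) + fgen (Inr i) * fgen (Inl i)))
    + (9 * t\<^sup>2 * r) *\<^sub>R 1)"
proof -
  let ?e = "\<lambda>i. fgen (Inl i) :: (nat + nat) free_alg" and ?u = "\<lambda>i. fgen (Inr i)"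
  have "T_elem n t r = coeffs (- (\<Sum>i<n. ?u i * ?u i) + (3 * t - 1) *\<^sub>R
      (- (\<Sum>i<n. (?e i + ?u i) * (?e i + ?u i)) - - (\<Sum>i<n. ?u i * ?u i) - - (\<Sum>i<n. ?e i * ?e i))
      + (9 * t\<^sup>2 * r) *\<^sub>R 1)"
    by (simp only: T_elem_def cas_right_def cas_left_def cas_coproduct_def coeffs_simps coeffs_sum coeffs_fgen)
  also have "- (\<Sum>i<n. (?e i + ?u i) * (?e i + ?u i)) - - (\<Sum>i<n. ?u i * ?u i) - - (\<Sum>i<n. ?e i * ?e i) =
      - (\<Sum>i<n. ?e i * ?u i + ?u i * ?e i)"
    by (simp add: algebra_simps sum.distrib)
  finally show ?thesis .
qed

theorem theorem2p3:
  fixes br :: "'g::euclidean_space \<Rightarrow> 'g \<Rightarrow> 'g"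
    and X :: "nat \<Rightarrow> 'g" and n :: nat and T P :: "'g set" and t :: real
  assumes "lie_algebra br"
    and "invariant_ip br"
    and "orthonormal_basis n X"
    and "maximal_torus br T"
    and "positive_system br T P"
  shows "clU_eq br X n
           (fa_mult (dirac_D br X n t) (dirac_D br X n t))
           (pi_tensor_one br X n (T_elem n t ((norm (weyl_vector P))^2)))"
proof -
  interpret compact_lie_torus br T
    using assms by unfold_locales
  note X = \<open>orthonormal_basis n X\<close>
  define e u where "e i = fgen (Inl i :: nat + nat)" and "u i = fgen (Inr i :: nat + nat)" for i
  have uc [simp]: "coeffs (e i) = cl_e i" "coeffs (u i) = cl_u i" for i
    by (simp_all add: e_def u_def)
  define R where "R = clU_relators br X n"
  \<comment> \<open>The ideal of the relators, seen in \<open>free_alg\<close>; congruence modulo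
    \<open>I\<close> is then \<open>clU_eq\<close>.\<close>
  define I where "I = {x. coeffs x \<in> fa_ideal R}"
  interpret ideal_cong I
    by unfold_locales
      (simp_all add: I_def coeffs_simps fa_ideal.zero fa_ideal.add fa_ideal_lmult fa_ideal_rmult)
  interpret CU: clifford_envelope I n e u "sc br X" "\<lambda>i j. if i = j then 2 else 0"
  proof unfold_locales
    fix i j assume ij: "i < n" "j < n"
    \<comment> \<open>Orthonormality matches the constant of the Clifford relator with
      \<open>d i j\<close>.\<close>
    have "(if i = j then 2 else 0) = 2 * inner (X i) (X j)"
      using X ij by (simp add: orthonormal_basis_def)
    then have "coeffs (e i * e j + e j * e i + (if i = j then 2 else 0) *\<^sub>R 1) \<in> R"
      unfolding R_def clU_relators_def using ij by (auto simp: coeffs_simps)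
    then show "e i * e j + e j * e i + (if i = j then 2 else 0) *\<^sub>R 1 \<in> I"
      by (simp add: I_def fa_ideal.gen)
    have "coeffs (u i * u j - u j * u i - (\<Sum>k<n. sc br X k i j *\<^sub>R u k)) \<in> R"
      unfolding R_def clU_relators_def using ij by (auto simp: coeffs_simps coeffs_sum)
    then show "cong (u i * u j - u j * u i) (\<Sum>k<n. sc br X k i j *\<^sub>R u k)"
      unfolding cong_def by (simp add: I_def fa_ideal.gen)
    have "coeffs (e i * u j - u j * e i) \<in> R"
      unfolding R_def clU_relators_def using ij
      by (intro UnI2 CollectI exI[of _ i] exI[of _ j]) (simp add: coeffs_simps)
    then show "cong (e i * u j) (u j * e i)"
      unfolding cong_def by (simp add: I_def fa_ideal.gen)
  next
    show "sc br X i j k = - sc br X j i k" "sc br X i j k = - sc br X i k j" for i j k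
      by (rule sc_anti1 sc_anti2)+
    show "(\<Sum>m<n. sc br X m i j * sc br X m k l + sc br X m j k * sc br X m i l
      + sc br X m k i * sc br X m j l) = 0" for i j k l
      by (rule sc_jacobi[OF X])
  qed
  define r where "r = (norm (weyl_vector P))\<^sup>2"
  \<comment> \<open>Here the strange formula enters: 3/8 \<open>CU.B\<close> becomes 9
    |\<rho>|^2.\<close>
  have B: "CU.B = 24 * r"
    unfolding CU.B_def sum_sc_square[OF X] r_def
    by (rule strange_formula) fact
  have D: "dirac_D br X n t = coeffs (CU.D0 + t *\<^sub>R CU.H)"
  proof -
    have "cubic_H br X n = coeffs CU.H"
      by (simp add: cubic_H_def CU.H_def coeffs_simps coeffs_sum fa_sum_Times3)
    then show ?thesis by (simp add: dirac_D_def CU.D0_def coeffs_simps coeffs_sum)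
  qed
  have pi: "pi_gen br X n i = coeffs (CU.P i)" for i
    by (simp add: pi_gen_def CU.P_def coeffs_simps coeffs_sum fa_sum_Times)
  have T: "pi_tensor_one br X n (T_elem n t r) = coeffs (- (\<Sum>i<n. u i * u i)
      + (3 * t - 1) *\<^sub>R (- (\<Sum>i<n. CU.P i * u i + u i * CU.P i)) + (3 / 8 * t\<^sup>2 * CU.B) *\<^sub>R 1)"
  proof -
    have "3 / 8 * t\<^sup>2 * CU.B = 9 * t\<^sup>2 * r" using B by simp
    then show ?thesis
      unfolding pi_tensor_one_def T_elem_eq fa_hom_coeffs
      by (simp only: coeffs_simps coeffs_sum uc pi sum.case)
  qed
  show ?thesis
    using CU.Dirac_square[of t]
    unfolding cong_def by (simp add: clU_eq_def D T r_def[symmetric] I_def R_def coeffs_simps)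
qed

end
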